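(* Let $n\geq 2$ be an integer and $\kappa\geq 0$. Assume the metric measure space $(X^n,d,\mu)$ satisfies the $n$-dimensional condition and the curvature-dimension condition ${\rm CD}(\kappa,n)$. Then ${\rm Sc}^{{\rm vol}_n}(X^n)\geq n\kappa$ (for $\kappa=0$ this means ${\rm Sc}^{{\rm vol}_n}(X^n)\geq 0$).
   Context: A metric measure space (mm-space) $(X,d,\mu)$ consists of a complete separable length metric $d$ on $X$ and a locally finite Borel measure $\mu$ of full support. ${\rm CD}(\kappa,n)$ is the Lott--Sturm--Villani curvature-dimension condition (in Sturm's formulation). $B_r(x)$ denotes the closed $r$-ball about $x$ and ${\rm vol}_E(B_r(\mathbf{R}^n))$ the Euclidean volume of a closed $r$-ball in $\mathbf{R}^n$. The $n$-dimensional condition: $\lim_{r\to 0}\mu(B_r(x))/{\rm vol}_E(B_r(\mathbf{R}^n))=1$ for every $x\in X$. For $\gamma>0$ let $S^2(\gamma)$ be the round 2-sphere with scalar curvature $2\gamma^{-2}$, and let $S^2(\gamma)\times\mathbf{R}^{n-2}$ carry the product metric $\sqrt{d_S^2+d_E^2}$ and product volume measure; its $\epsilon$-balls all have the same volume ${\rm vol}_{S\times E}(B_\epsilon(S^2(\gamma)\times\mathbf{R}^{n-2}))$. For an mm-space $X$ satisfying the $n$-dimensional condition: ${\rm Sc}^{{\rm vol}_n}(X)\geq 0$ means there is $r>0$ with $\mu(B_\epsilon(x))\leq{\rm vol}_E(B_\epsilon(\mathbf{R}^n))$ for all $x\in X$ and $0<\epsilon\leq r$; for $K>0$, ${\rm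 Sc}^{{\rm vol}_n}(X)\geq K$ means that for every $\gamma>\sqrt{2/K}$ there is $r_\gamma>0$ with $\mu(B_\epsilon(x))<{\rm vol}_{S\times E}(B_\epsilon(S^2(\gamma)\times\mathbf{R}^{n-2}))$ for all $x\in X$ and $0<\epsilon\leq r_\gamma$. *)

theory Defs
  imports "HOL-Probability.Probability"
begin

text \<open>Complete separability is imposed through the type class polish_space;
the metric d is dist. A length metric: d(x,y) is the infimum of lengths of
continuous curves from x to y, the length being the supremum over partitions.\<close>

definition length_metric :: "('a::metric_space) itself \<Rightarrow> bool" where
  "length_metric _ \<longleftrightarrow>
     (\<forall>(x::'a) y (e::real). e > 0 \<longrightarrow>
        (\<exists>c::real \<Rightarrow> 'a. continuous_on {0..1} c \<and> c 0 = x \<and> c 1 = y \<and>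
           (\<forall>(k::nat) (s::nat \<Rightarrow> real). s 0 = 0 \<and> s k = 1 \<and> (\<forall>i<k. s i \<le> s (Suc i)) \<longrightarrow>
              (\<Sum>i<k. dist (c (s i)) (c (s (Suc i)))) \<le> dist x y + e)))"

definition mm_space :: "('a::polish_space) measure \<Rightarrow> bool" where
  "mm_space \<mu> \<longleftrightarrow> length_metric TYPE('a) \<and> sets \<mu> = sets borel \<and>
     (\<forall>x. \<exists>r>0. emeasure \<mu> (ball x r) < \<infinity>) \<and>
     (\<forall>x r. r > 0 \<longrightarrow> emeasure \<mu> (ball x r) > 0)"

definition P2 :: "('a::metric_space) measure \<Rightarrow> bool" where
  "P2 \<nu> \<longleftrightarrow> prob_space \<nu> \<and> sets \<nu> = sets borel \<and>
     (\<exists>x0. (\<integral>\<^sup>+x. ennreal (dist x0 x ^ 2) \<partial>\<nu>) < \<infinity>)"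

definition Pinf :: "('a::metric_space) measure \<Rightarrow> 'a measure \<Rightarrow> bool" where
  "Pinf m \<nu> \<longleftrightarrow> P2 \<nu> \<and> absolutely_continuous m \<nu> \<and>
     (\<exists>B. bounded B \<and> B \<in> sets borel \<and> emeasure \<nu> (UNIV - B) = 0)"

definition coupling :: "('a::metric_space) measure \<Rightarrow> 'a measure \<Rightarrow> ('a \<times> 'a) measure \<Rightarrow> bool" where
  "coupling \<nu>0 \<nu>1 q \<longleftrightarrow> prob_space q \<and> sets q = sets (borel \<Otimes>\<^sub>M borel) \<and>
     distr q borel fst = \<nu>0 \<and> distr q borel snd = \<nu>1"

definition transport_cost :: "(('a::metric_space) \<times> 'a) measure \<Rightarrow> ennreal" where
  "transport_cost q = (\<integral>\<^sup>+p. ennreal (dist (fst p) (snd p) ^ 2) \<partial>q)"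

definition W2sq :: "('a::metric_space) measure \<Rightarrow> 'a measure \<Rightarrow> ennreal" where
  "W2sq \<nu>0 \<nu>1 = (INF q\<in>{q. coupling \<nu>0 \<nu>1 q}. transport_cost q)"

definition optimal_coupling :: "('a::metric_space) measure \<Rightarrow> 'a measure \<Rightarrow> ('a \<times> 'a) measure \<Rightarrow> bool" where
  "optimal_coupling \<nu>0 \<nu>1 q \<longleftrightarrow> coupling \<nu>0 \<nu>1 q \<and> transport_cost q = W2sq \<nu>0 \<nu>1"

definition W2_geodesic :: "(real \<Rightarrow> ('a::metric_space) measure) \<Rightarrow> 'a measure \<Rightarrow> 'a measure \<Rightarrow> bool" where
  "W2_geodesic G \<nu>0 \<nu>1 \<longleftrightarrow> G 0 = \<nu>0 \<and> G 1 = \<nu>1 \<and> (\<forall>t\<in>{0..1}. P2 (G t)) \<and>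
     (\<forall>s\<in>{0..1}. \<forall>t\<in>{0..1}. W2sq (G s) (G t) = ennreal ((s - t)^2) * W2sq \<nu>0 \<nu>1)"

text \<open>sigma^(t)_{K,N}(theta) in the finite range K theta^2 < N pi^2.\<close>
definition sigma_fin :: "real \<Rightarrow> real \<Rightarrow> real \<Rightarrow> real \<Rightarrow> real" where
  "sigma_fin K N t \<theta> =
     (if K * \<theta>^2 > 0 then sin (t * \<theta> * sqrt (K / N)) / sin (\<theta> * sqrt (K / N))
      else if K * \<theta>^2 = 0 then t
      else sinh (t * \<theta> * sqrt (- K / N)) / sinh (\<theta> * sqrt (- K / N)))"

text \<open>tau^(t)_{K,N}(theta) = t^(1/N) sigma^(t)_{K,N-1}(theta)^(1-1/N), with value
infinity when K theta^2 >= (N-1) pi^2 (convention 0 * infinity = 0 at t = 0).\<close>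
definition tau :: "real \<Rightarrow> real \<Rightarrow> real \<Rightarrow> real \<Rightarrow> ennreal" where
  "tau K N t \<theta> =
     (if K * \<theta>^2 \<ge> (N - 1) * pi^2 then (if t = 0 then 0 else \<infinity>)
      else ennreal (t powr (1 / N) * sigma_fin K (N - 1) t \<theta> powr (1 - 1 / N)))"

definition CD :: "real \<Rightarrow> real \<Rightarrow> ('a::metric_space) measure \<Rightarrow> bool" where
  "CD K N m \<longleftrightarrow>
    (\<forall>\<nu>0 \<nu>1. Pinf m \<nu>0 \<and> Pinf m \<nu>1 \<longrightarrow>
      (\<exists>q G. optimal_coupling \<nu>0 \<nu>1 q \<and> W2_geodesic G \<nu>0 \<nu>1 \<and>
        (\<forall>t\<in>{0..1}. \<forall>N'\<ge>N.
          \<comment> \<open>Lebesgue decomposition G t = rho m + singular part; the Renyi entropy is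
              S_N'(G t | m) = - integral of rho^(1-1/N') dm\<close>
          (\<exists>\<rho> \<nu>s. \<rho> \<in> borel_measurable borel \<and> (\<forall>x. \<rho> x \<ge> 0) \<and> sets \<nu>s = sets borel \<and>
             (\<exists>Z\<in>sets borel. emeasure m Z = 0 \<and> emeasure \<nu>s (UNIV - Z) = 0) \<and>
             (\<forall>A\<in>sets borel. emeasure (G t) A = emeasure (density m (\<lambda>x. ennreal (\<rho> x))) A + emeasure \<nu>s A) \<and>
             (\<integral>\<^sup>+p. tau K N' (1 - t) (dist (fst p) (snd p)) *
                       ennreal (enn2real (RN_deriv m \<nu>0 (fst p)) powr (- 1 / N'))
                   + tau K N' t (dist (fst p) (snd p)) *
                       ennreal (enn2real (RN_deriv m \<nu>1 (snd p)) powr (- 1 / N')) \<partial>q)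
             \<le> (\<integral>\<^sup>+x. ennreal (\<rho> x powr (1 - 1 / N')) \<partial>m)))))"

definition vol_E :: "nat \<Rightarrow> real \<Rightarrow> real" where
  "vol_E n r = unit_ball_vol (real n) * r ^ n"

definition n_dimensional :: "nat \<Rightarrow> ('a::metric_space) measure \<Rightarrow> bool" where
  "n_dimensional n \<mu> \<longleftrightarrow>
     (\<forall>x. ((\<lambda>r. measure \<mu> (cball x r) / vol_E n r) \<longlongrightarrow> 1) (at_right 0))"

text \<open>Round sphere S^2(gamma) = sphere 0 gamma in R^3 (scalar curvature 2/gamma^2),
with its surface measure, realised as the cone measure: the push-forward of
(3/gamma) times Lebesgue measure on the ball under radial projection.\<close>
definition sphere_measure :: "real \<Rightarrow> (real^3) measure" where
  "sphere_measure \<gamma> =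
     distr (density lborel (\<lambda>x. ennreal (3 / \<gamma>) * indicator (ball 0 \<gamma>) x)) borel
           (\<lambda>x. (\<gamma> / norm x) *\<^sub>R x)"

definition sphere_dist :: "real \<Rightarrow> real^3 \<Rightarrow> real^3 \<Rightarrow> real" where
  "sphere_dist \<gamma> p p' = \<gamma> * arccos ((p \<bullet> p') / \<gamma>^2)"

text \<open>Volume of the closed eps-ball about (p0, 0) in S^2(gamma) x R^(n-2) with the
product metric sqrt(d_S^2 + d_E^2) and product measure; R^(n-2) is modelled as
functions on {..<n-2} with the product Lebesgue measure.\<close>
definition vol_SxE :: "real \<Rightarrow> nat \<Rightarrow> real \<Rightarrow> ennreal" where
  "vol_SxE \<gamma> n \<epsilon> =
     emeasure (sphere_measure \<gamma> \<Otimes>\<^sub>M (\<Pi>\<^sub>M i\<in>{..<n-2}. lborel))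
       {(p, v). norm p = \<gamma> \<and> v \<in> (\<Pi>\<^sub>E i\<in>{..<n-2}. UNIV) \<and>
          sqrt ((sphere_dist \<gamma> (axis 1 \<gamma>) p)^2 + (\<Sum>i<n-2. (v i)^2)) \<le> \<epsilon>}"

definition Sc_vol_ge_0 :: "nat \<Rightarrow> ('a::metric_space) measure \<Rightarrow> bool" where
  "Sc_vol_ge_0 n \<mu> \<longleftrightarrow>
     (\<exists>r>0. \<forall>x \<epsilon>. 0 < \<epsilon> \<and> \<epsilon> \<le> r \<longrightarrow> emeasure \<mu> (cball x \<epsilon>) \<le> ennreal (vol_E n \<epsilon>))"

definition Sc_vol_ge_pos :: "nat \<Rightarrow> real \<Rightarrow> ('a::metric_space) measure \<Rightarrow> bool" where
  "Sc_vol_ge_pos n K \<mu> \<longleftrightarrow>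
     (\<forall>\<gamma>. \<gamma> > sqrt (2 / K) \<longrightarrow>
        (\<exists>r>0. \<forall>x \<epsilon>. 0 < \<epsilon> \<and> \<epsilon> \<le> r \<longrightarrow> emeasure \<mu> (cball x \<epsilon>) < vol_SxE \<gamma> n \<epsilon>))"

end

theory Submission
  imports Defs
begin

text \<open>
  Fix x and transport the uniform measure of a tiny ball around x to the uniform measure of a
  set A in the \<epsilon>-ball about x. The time-t measure of the Wasserstein geodesic lives in a ball of radius about
  t \<epsilon>, so by Hoelder's inequality its Renyi entropy is controlled by the volume of that ball, which the
  n-dimensional condition evaluates as t tends to 0. With \<omega> the volume of the Euclidean unit ball,
  the CD inequality becomes

  \<mu>(A)^(1/n) (1 + \<kappa>/(6n) \<integral> d(x,y)^2) \<le> \<omega>^(1/n) \<epsilon>,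

  the integral being the mean over y in A. Dropping the \<kappa>-term gives \<mu>(B_s(x)) \<le> \<omega> s^n for all
  small s, and this in turn bounds the second moment on A = B_\<epsilon>(x) from below. Inserting that bound
  yields the volume expansion 1 - n\<kappa> \<epsilon>^2/(6(n+2)) to second order without a decomposition into
  annuli, while for S^2(\<gamma>) x R^(n-2) the second order coefficient is only 2/(6(n+2)\<gamma>^2).
\<close>

subsection \<open>Approximate gluing of couplings\<close>

text \<open>CD supplies the coupling \<open>q\<close> and the curve \<open>G\<close> as two separate
  objects; nothing says that \<open>G t\<close> is made of points on geodesics between points paired
  by \<open>q\<close>. Where \<open>G t\<close> lives must be read off from Wasserstein distances
  alone: a plan through \<open>G t\<close> that overshoots would cost more than these distances
  permit. Comparing costs requires plans over three points, hence the gluing; a defect e in the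
  middle point is harmless because e tends to 0. A second obstacle is uniformity. The n-dimensional
  condition has no rate common to all x, yet one radius must serve all x. The limit t to 0 is
  therefore taken at fixed x and \<epsilon>, and the volume bounds hold whenever \<kappa>
  \<epsilon>^2 < 1. The target is a general set A because finiteness of the \<epsilon>-ball is
  itself a conclusion. The coefficient n\<kappa>/(6(n+2)) is \<kappa>/6 times n/(n+2): the first is
  n times \<kappa>/(6n), the second is the mean of |y|^2 over the Euclidean unit ball.\<close>

lemma countable_small_diam_labelling:
  fixes e :: real
  assumes "e > 0"
  obtains k :: "'a::{metric_space,second_countable_topology} \<Rightarrow> nat"
  where "k \<in> measurable borel (count_space UNIV)"
    and "\<And>x y. k x = k y \<Longrightarrow> dist x y < e"
proof -
  obtain S :: "'a set" where S: "countable S" and dense: "\<And>X. open X \<Longrightarrow> X \<noteq> {} \<Longrightarrow> \<exists>d\<in>S. d \<in> X"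
    using countable_dense_exists by blast
  have "S \<noteq> {}" using dense[of UNIV] by auto
  define d where "d = from_nat_into S"
  have near: "\<exists>i. dist (d i) x < e/2" for x
  proof -
    obtain y where "y \<in> S" "y \<in> ball x (e/2)"
      using dense[of "ball x (e/2)"] assms by auto
    moreover then obtain i where "d i = y"
      unfolding d_def using from_nat_into_surj[OF S] by metis
    ultimately show ?thesis by (auto simp: dist_commute)
  qed
  \<comment> \<open>Labelling by the first dense point within e/2 makes the cells disjoint by
    construction, so measurability is that of \<open>LEAST\<close> over countably many open
    conditions.\<close>
  define k where "k = (\<lambda>x. LEAST i. dist (d i) x < e/2)"
  have "k \<in> measurable borel (count_space UNIV)"
    unfolding k_def by measurable
  moreover have "dist x y < e" if "k x = k y" for x y
  proof -
    have *: "dist (d (k z)) z < e/2" for z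
      unfolding k_def using near[of z] by (rule LeastI_ex)
    have "dist x y \<le> dist (d (k x)) x + dist (d (k x)) y"
      by (rule dist_triangle3)
    with *[of x] *[of y] that show ?thesis by simp
  qed
  ultimately show ?thesis using that by blast
qed

lemma coupling_space:
  assumes "coupling \<nu>0 \<nu>1 q"
  shows "prob_space q" "sets q = sets (borel \<Otimes>\<^sub>M borel)" "space q = UNIV"
    "distr q borel fst = \<nu>0" "distr q borel snd = \<nu>1"
    "fst \<in> measurable q borel" "snd \<in> measurable q borel"
proof -
  show *: "prob_space q" "sets q = sets (borel \<Otimes>\<^sub>M borel)" "distr q borel fst = \<nu>0" "distr q borel snd = \<nu>1"
    using assms by (auto simp: coupling_def)
  show "space q = UNIV" using sets_eq_imp_space_eq[OF *(2)] by (simp add: space_pair_measure)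
  show "fst \<in> measurable q borel" "snd \<in> measurable q borel"
    using measurable_cong_sets[OF *(2) refl] by auto
qed

text \<open>A cell of the labelling has the same mass under both couplings, because they share the
  marginal \<nu>. Renormalising the product measure on matching cells therefore preserves
  \<open>q1\<close> and \<open>q2\<close> exactly; the price is that the two copies of the middle
  point agree only up to e.\<close>

lemma approximate_gluing:
  fixes q1 q2 :: "('a::{metric_space,second_countable_topology} \<times> 'a) measure"
  assumes q1: "coupling \<nu>0 \<nu> q1" and q2: "coupling \<nu> \<nu>1 q2" and "e > 0"
  obtains Q where "sets Q = sets (q1 \<Otimes>\<^sub>M q2)" "distr Q q1 fst = q1" "distr Q q2 snd = q2"
    "AE w in Q. dist (snd (fst w)) (fst (snd w)) < e"
proof -
  obtain k :: "'a \<Rightarrow> nat" where k[measurable]: "k \<in> measurable borel (count_space UNIV)"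
    and k_near: "\<And>x y. k x = k y \<Longrightarrow> dist x y < e"
    using countable_small_diam_labelling[OF \<open>e > 0\<close>] by metis
  interpret q1: prob_space q1 by (rule coupling_space[OF q1])
  interpret q2: prob_space q2 by (rule coupling_space[OF q2])
  interpret pair_prob_space q1 q2 ..
  note [measurable] = coupling_space(6,7)[OF q1] coupling_space(6,7)[OF q2]
  have sp[simp]: "space q1 = UNIV" "space q2 = UNIV"
    using coupling_space(3)[OF q1] coupling_space(3)[OF q2] by auto
  define c where "c i = emeasure \<nu> {z. k z = i}" for i
  have c1: "c i = emeasure q1 {p. k (snd p) = i}" for i
    unfolding c_def coupling_space(5)[OF q1, symmetric]
    by (subst emeasure_distr) (auto simp: vimage_def)
  have c2: "c i = emeasure q2 {p. k (fst p) = i}" for i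
    unfolding c_def coupling_space(4)[OF q2, symmetric]
    by (subst emeasure_distr) (auto simp: vimage_def)
  have m1[measurable]: "{p. k (snd p) = i} \<in> sets q1" for i
  proof -
    have "{p \<in> space q1. k (snd p) = i} \<in> sets q1" by measurable
    then show ?thesis by simp
  qed
  have m2[measurable]: "{p. k (fst p) = i} \<in> sets q2" for i
  proof -
    have "{p \<in> space q2. k (fst p) = i} \<in> sets q2" by measurable
    then show ?thesis by simp
  qed
  have cfin: "c i \<noteq> \<infinity>" for i unfolding c1 by simp
  \<comment> \<open>Cells of mass zero, where the normalising factor below is infinite, are met with
    probability zero since there are only countably many cells.\<close>
  have ae1: "AE p in q1. c (k (snd p)) \<noteq> 0"
  proof -
    have "AE p in q1. \<forall>i. c i = 0 \<longrightarrow> k (snd p) \<noteq> i"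
    proof (subst AE_all_countable, intro allI)
      fix i show "AE p in q1. c i = 0 \<longrightarrow> k (snd p) \<noteq> i"
        by (cases "c i = 0") (auto simp: c1 intro!: AE_I[where N="{p. k (snd p) = i}"])
    qed
    then show ?thesis by eventually_elim auto
  qed
  have ae2: "AE p in q2. c (k (fst p)) \<noteq> 0"
  proof -
    have "AE p in q2. \<forall>i. c i = 0 \<longrightarrow> k (fst p) \<noteq> i"
    proof (subst AE_all_countable, intro allI)
      fix i show "AE p in q2. c i = 0 \<longrightarrow> k (fst p) \<noteq> i"
        by (cases "c i = 0") (auto simp: c2 intro!: AE_I[where N="{p. k (fst p) = i}"])
    qed
    then show ?thesis by eventually_elim auto
  qed
  \<comment> \<open>Conditionally independent gluing along the cells of the partition, so no disintegration is needed.\<close>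
  define f :: "('a \<times> 'a) \<times> ('a \<times> 'a) \<Rightarrow> ennreal" where
    "f w = (if k (snd (fst w)) = k (fst (snd w)) then inverse (c (k (snd (fst w)))) else 0)" for w
  have K1: "(\<lambda>w. k (snd (fst w))) \<in> measurable (q1 \<Otimes>\<^sub>M q2) (count_space UNIV)"
    by (intro measurable_compose[OF measurable_fst] measurable_compose[OF coupling_space(7)[OF q1] k])
  have K2: "(\<lambda>w. k (fst (snd w))) \<in> measurable (q1 \<Otimes>\<^sub>M q2) (count_space UNIV)"
    by (intro measurable_compose[OF measurable_snd] measurable_compose[OF coupling_space(6)[OF q2] k])
  have f[measurable]: "f \<in> borel_measurable (q1 \<Otimes>\<^sub>M q2)"
    unfolding f_def
    by (intro measurable_If measurable_compose[OF K1] borel_measurable_const measurable_count_space_eq1[THEN iffD2]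
          pred_count_space_const1 predE[OF measurable_compose_countable[OF _ K1]]
          measurable_compose[OF K2]) auto
  define Q where "Q = density (q1 \<Otimes>\<^sub>M q2) f"
  have int2: "(\<integral>\<^sup>+w2. f (w1, w2) \<partial>q2) = 1" if "c (k (snd w1)) \<noteq> 0" for w1
  proof -
    have "(\<integral>\<^sup>+w2. f (w1, w2) \<partial>q2) = (\<integral>\<^sup>+w2. inverse (c (k (snd w1))) * indicator {p. k (fst p) = k (snd w1)} w2 \<partial>q2)"
      by (intro nn_integral_cong) (auto simp: f_def indicator_def)
    also have "\<dots> = inverse (c (k (snd w1))) * c (k (snd w1))"
      by (subst nn_integral_cmult_indicator) (auto simp: c2)
    also have "\<dots> = 1" using ennreal_divide_self[OF that] cfin[of "k (snd w1)"]
      by (simp add: divide_ennreal_def mult.commute less_top)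
    finally show ?thesis .
  qed
  have int1: "(\<integral>\<^sup>+w1. f (w1, w2) \<partial>q1) = 1" if "c (k (fst w2)) \<noteq> 0" for w2
  proof -
    have "(\<integral>\<^sup>+w1. f (w1, w2) \<partial>q1) = (\<integral>\<^sup>+w1. inverse (c (k (fst w2))) * indicator {p. k (snd p) = k (fst w2)} w1 \<partial>q1)"
      by (intro nn_integral_cong) (auto simp: f_def indicator_def)
    also have "\<dots> = inverse (c (k (fst w2))) * c (k (fst w2))"
      by (subst nn_integral_cmult_indicator) (auto simp: c1)
    also have "\<dots> = 1" using ennreal_divide_self[OF that] cfin[of "k (fst w2)"]
      by (simp add: divide_ennreal_def mult.commute less_top)
    finally show ?thesis .
  qed
  have sQ: "sets Q = sets (q1 \<Otimes>\<^sub>M q2)" by (simp add: Q_def)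
  have [measurable]: "fst \<in> measurable Q q1" "snd \<in> measurable Q q2"
    by (auto simp: measurable_cong_sets[OF sQ refl])
  have "distr Q q1 fst = q1"
  proof (rule measure_eqI)
    fix A assume "A \<in> sets (distr Q q1 fst)"
    then have A[measurable]: "A \<in> sets q1" by simp
    have "emeasure (distr Q q1 fst) A = emeasure Q (fst -` A)"
      by (subst emeasure_distr) (auto simp: Q_def space_pair_measure)
    also have "\<dots> = (\<integral>\<^sup>+w. f w * indicator A (fst w) \<partial>(q1 \<Otimes>\<^sub>M q2))"
      unfolding Q_def
      by (subst emeasure_density) (auto simp: space_pair_measure indicator_def intro!: nn_integral_cong
           measurable_sets[of fst "q1 \<Otimes>\<^sub>M q2" q1 A, simplified space_pair_measure sp, simplified])
    also have "\<dots> = (\<integral>\<^sup>+w1. \<integral>\<^sup>+w2. f (w1, w2) * indicator A w1 \<partial>q2 \<partial>q1)"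
      by (subst q2.nn_integral_fst[symmetric]) auto
    also have "\<dots> = (\<integral>\<^sup>+w1. indicator A w1 \<partial>q1)"
    proof (intro nn_integral_cong_AE, use ae1 in eventually_elim)
      fix w1 :: "'a \<times> 'a" assume *: "c (k (snd w1)) \<noteq> 0"
      have "(\<integral>\<^sup>+w2. f (w1, w2) * indicator A w1 \<partial>q2) = (\<integral>\<^sup>+w2. f (w1, w2) \<partial>q2) * indicator A w1"
        by (rule nn_integral_multc) auto
      then show "(\<integral>\<^sup>+w2. f (w1, w2) * indicator A w1 \<partial>q2) = indicator A w1"
        using int2[OF *] by simp
    qed
    finally show "emeasure (distr Q q1 fst) A = emeasure q1 A" by simp
  qed simp
  moreover have "distr Q q2 snd = q2"
  proof (rule measure_eqI)
    fix A assume "A \<in> sets (distr Q q2 snd)"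
    then have A[measurable]: "A \<in> sets q2" by simp
    have "emeasure (distr Q q2 snd) A = emeasure Q (snd -` A)"
      by (subst emeasure_distr) (auto simp: Q_def space_pair_measure)
    also have "\<dots> = (\<integral>\<^sup>+w. f w * indicator A (snd w) \<partial>(q1 \<Otimes>\<^sub>M q2))"
      unfolding Q_def
      by (subst emeasure_density) (auto simp: space_pair_measure indicator_def intro!: nn_integral_cong
           measurable_sets[of snd "q1 \<Otimes>\<^sub>M q2" q2 A, simplified space_pair_measure sp, simplified])
    also have "\<dots> = (\<integral>\<^sup>+w2. \<integral>\<^sup>+w1. f (w1, w2) * indicator A w2 \<partial>q1 \<partial>q2)"
      by (subst nn_integral_snd[symmetric]) auto
    also have "\<dots> = (\<integral>\<^sup>+w2. indicator A w2 \<partial>q2)"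
    proof (intro nn_integral_cong_AE, use ae2 in eventually_elim)
      fix w2 :: "'a \<times> 'a" assume *: "c (k (fst w2)) \<noteq> 0"
      have "(\<integral>\<^sup>+w1. f (w1, w2) * indicator A w2 \<partial>q1) = (\<integral>\<^sup>+w1. f (w1, w2) \<partial>q1) * indicator A w2"
        by (rule nn_integral_multc) auto
      then show "(\<integral>\<^sup>+w1. f (w1, w2) * indicator A w2 \<partial>q1) = indicator A w2"
        using int1[OF *] by simp
    qed
    finally show "emeasure (distr Q q2 snd) A = emeasure q2 A" by simp
  qed simp
  moreover have "AE w in Q. dist (snd (fst w)) (fst (snd w)) < e"
    unfolding Q_def by (subst AE_density[OF f]) (auto simp: f_def k_near intro!: AE_I2)
  ultimately show ?thesis using that sQ by blast
qed

subsection \<open>Concentration of intermediate measures\<close>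

text \<open>
  Here a, b and D stand for the distances from a starting point to an intermediate point, from there to an
  end point, and from start to end; e is the gluing defect. Overshooting the expected distance t D by s costs
  an extra s^2/t, whereas near optimality leaves only an excess of order e.
\<close>

lemma intermediate_cost_gap:
  fixes a b D e s t R :: real
  assumes "0 < t" "t < 1" "0 \<le> a" "0 \<le> b" "0 \<le> D" "D \<le> R" "0 < e" "0 < s" "D \<le> a + b + e"
  shows "D\<^sup>2 + (if t * D + s \<le> a then s\<^sup>2 / t else 0) \<le> a\<^sup>2 / t + b\<^sup>2 / (1 - t) + 2 * e * R"
proof -
  \<comment> \<open>Lowering the end distance by the defect e restores a true triangle inequality D'
    \<le> a + b; in the squares this loses at most 2eD.\<close>
  define D' where "D' = max 0 (D - e)"
  have D': "0 \<le> D'" "D' \<le> D" "D' \<le> a + b" using assms by (auto simp: D'_def)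
  have "D\<^sup>2 \<le> D'\<^sup>2 + 2 * e * D"
  proof (cases "D \<le> e")
    case True
    have "D * D \<le> e * D" using True assms by (intro mult_right_mono) auto
    moreover have "0 \<le> e * D" using assms by simp
    ultimately show ?thesis using True by (simp add: D'_def power2_eq_square)
  next
    case False
    then show ?thesis by (simp add: D'_def power2_eq_square algebra_simps)
  qed
  moreover have "2 * e * D \<le> 2 * e * R" using assms by simp
  ultimately have DD: "D\<^sup>2 \<le> D'\<^sup>2 + 2 * e * R" by linarith
  \<comment> \<open>Convexity of the square with its exact defect: the last term vanishes precisely
    when x is the share t of x + y.\<close>
  have id: "x\<^sup>2 / t + y\<^sup>2 / (1 - t) = (x + y)\<^sup>2 + (x - t * (x + y))\<^sup>2 / (t * (1 - t))" for x y :: real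
    using assms by (simp add: field_simps power2_eq_square)
  have "D'\<^sup>2 + (if t * D + s \<le> a then s\<^sup>2 / t else 0) \<le> a\<^sup>2 / t + b\<^sup>2 / (1 - t)"
  proof (cases "t * D + s \<le> a")
    case False
    have "D'\<^sup>2 \<le> (a + b)\<^sup>2" using D' by (intro power_mono) auto
    also have "\<dots> \<le> a\<^sup>2 / t + b\<^sup>2 / (1 - t)" unfolding id using assms by simp
    finally show ?thesis using False by simp
  next
    case True
    define u where "u = a - t * D'"
    have "t * D' \<le> t * D" using D' assms by simp
    then have u: "u \<ge> s" using True by (simp add: u_def)
    then have "u\<^sup>2 \<ge> s\<^sup>2" using assms by (intro power_mono) auto
    then have us: "s\<^sup>2 / t \<le> u\<^sup>2 / t" using assms by (simp add: divide_right_mono)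
    have "D'\<^sup>2 + u\<^sup>2 / t \<le> a\<^sup>2 / t + b\<^sup>2 / (1 - t)"
    \<comment> \<open>For a \<le> D' the second leg has length at least D' - a, and
      \<open>id\<close> applies with total length D'. For a > D' the first leg alone is so expensive
      that b may be estimated by 0.\<close>
    proof (cases "a \<le> D'")
      case True
      have "(D' - a)\<^sup>2 \<le> b\<^sup>2" using True D' by (intro power_mono) auto
      then have "(D' - a)\<^sup>2 / (1 - t) \<le> b\<^sup>2 / (1 - t)" using assms by (simp add: divide_right_mono)
      moreover have "a\<^sup>2 / t + (D' - a)\<^sup>2 / (1 - t) = D'\<^sup>2 + u\<^sup>2 / (t * (1 - t))"
        using id[of a "D' - a"] by (simp add: u_def)
      moreover have "u\<^sup>2 / t \<le> u\<^sup>2 / (t * (1 - t))"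
        using assms by (intro divide_left_mono) (auto simp: mult_left_le)
      ultimately show ?thesis by linarith
    next
      case False
      have "D' * D' \<le> D' * a" using False D' by (intro mult_left_mono) auto
      moreover have "t * (D' * D') \<le> D' * D'" using assms by (intro mult_left_le_one_le) auto
      ultimately have "t * D'\<^sup>2 + D'\<^sup>2 \<le> 2 * (D' * a)" by (simp add: power2_eq_square)
      moreover have "a\<^sup>2 / t - u\<^sup>2 / t = 2 * (D' * a) - t * D'\<^sup>2"
        using assms by (simp add: u_def field_simps power2_eq_square)
      moreover have "0 \<le> b\<^sup>2 / (1 - t)" using assms by simp
      ultimately show ?thesis by linarith
    qed
    then show ?thesis using us True by simp
  qed
  then show ?thesis using DD by linarith
qed

text \<open>A geodesic prescribes the distances to its intermediate measures but no optimal
  couplings with them, so these legs are realised only up to e.\<close>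

lemma nearly_optimal_coupling:
  assumes "W2sq \<nu>0 \<nu>1 = ennreal w" "0 \<le> w" "0 < e"
  obtains q where "coupling \<nu>0 \<nu>1 q" "transport_cost q < ennreal (w + e)"
proof -
  have "(INF q\<in>{q. coupling \<nu>0 \<nu>1 q}. transport_cost q) < ennreal (w + e)"
    using assms by (simp add: W2sq_def[symmetric])
  then show ?thesis using that by (auto simp: INF_less_iff)
qed

text \<open>Glue nearly optimal plans for the two legs. Weighted by 1/t and 1/(1 - t), the leg costs
  add up to w plus a multiple of e, whereas the end points of the glued plan form a coupling of
  \<nu>0 and \<nu>1 and so cost at least w. By \<open>intermediate_cost_gap\<close> each
  overshooting path wastes s^2/t, hence overshooting has mass of order e.\<close>

lemma intermediate_measure_tail:
  fixes \<nu>0 \<nu> \<nu>1 :: "'a::{metric_space,second_countable_topology} measure"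
  assumes W: "W2sq \<nu>0 \<nu>1 = ennreal w" "0 \<le> w"
    "W2sq \<nu>0 \<nu> = ennreal (t\<^sup>2 * w)" "W2sq \<nu> \<nu>1 = ennreal ((1 - t)\<^sup>2 * w)"
    and t: "0 < t" "t < 1" and "0 \<le> \<epsilon>" "0 \<le> \<delta>" "0 < s"
    and supp: "AE y in \<nu>0. dist x y \<le> \<delta>" "AE y in \<nu>1. dist x y \<le> \<epsilon>"
    and "0 < e"
  shows "emeasure \<nu> (UNIV - cball x (t * (\<epsilon> + \<delta>) + \<delta> + s)) \<le> ennreal (e * (1 / t + 1 / (1 - t) + 2 * (\<epsilon> + \<delta>)) * t / s\<^sup>2)"
proof -
  obtain q1 where q1: "coupling \<nu>0 \<nu> q1" and c1: "transport_cost q1 < ennreal (t\<^sup>2 * w + e)"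
    using nearly_optimal_coupling[OF W(3)] W(2) \<open>0 < e\<close> by auto
  obtain q2 where q2: "coupling \<nu> \<nu>1 q2" and c2: "transport_cost q2 < ennreal ((1 - t)\<^sup>2 * w + e)"
    using nearly_optimal_coupling[OF W(4)] W(2) \<open>0 < e\<close> by auto
  obtain Q where Q: "sets Q = sets (q1 \<Otimes>\<^sub>M q2)" "distr Q q1 fst = q1" "distr Q q2 snd = q2"
      and Qe: "AE w in Q. dist (snd (fst w)) (fst (snd w)) < e"
    by (rule approximate_gluing[OF q1 q2 \<open>0 < e\<close>])
  have mQ: "fst \<in> measurable Q q1" "snd \<in> measurable Q q2"
    by (auto simp: measurable_cong_sets[OF Q(1) refl])
  have X0[measurable]: "(\<lambda>w. fst (fst w)) \<in> measurable Q borel"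
    and Z[measurable]: "(\<lambda>w. snd (fst w)) \<in> measurable Q borel"
    and Z'[measurable]: "(\<lambda>w. fst (snd w)) \<in> measurable Q borel"
    and X1[measurable]: "(\<lambda>w. snd (snd w)) \<in> measurable Q borel"
    by (rule measurable_compose[OF mQ(1)] measurable_compose[OF mQ(2)],
        rule coupling_space(6,7)[OF q1] coupling_space(6,7)[OF q2])+
  have d0: "distr Q borel (\<lambda>w. fst (fst w)) = \<nu>0"
    using distr_distr[OF coupling_space(6)[OF q1] mQ(1)] coupling_space(4)[OF q1] Q(2) by (simp add: comp_def)
  have d: "distr Q borel (\<lambda>w. snd (fst w)) = \<nu>"
    using distr_distr[OF coupling_space(7)[OF q1] mQ(1)] coupling_space(5)[OF q1] Q(2) by (simp add: comp_def)
  have d1: "distr Q borel (\<lambda>w. snd (snd w)) = \<nu>1"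
    using distr_distr[OF coupling_space(7)[OF q2] mQ(2)] coupling_space(5)[OF q2] Q(3) by (simp add: comp_def)
  interpret q1: prob_space q1 by (rule coupling_space[OF q1])
  interpret Q: prob_space Q
    by (rule prob_space_distrD[OF mQ(1)]) (simp add: Q(2) q1.prob_space_axioms)
  define q where "q = distr Q (borel \<Otimes>\<^sub>M borel) (\<lambda>w. (fst (fst w), snd (snd w)))"
  have q: "coupling \<nu>0 \<nu>1 q"
    unfolding coupling_def q_def
    by (auto intro!: Q.prob_space_distr simp: distr_distr comp_def d0 d1)
  have cost: "ennreal w \<le> (\<integral>\<^sup>+w. ennreal ((dist (fst (fst w)) (snd (snd w)))\<^sup>2) \<partial>Q)"
  proof -
    have "ennreal w \<le> transport_cost q"
      unfolding W(1)[symmetric] W2sq_def using q by (auto intro!: INF_lower)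
    then show ?thesis unfolding transport_cost_def q_def
      by (subst (asm) nn_integral_distr) auto
  qed
  have cost1: "(\<integral>\<^sup>+w. ennreal ((dist (fst (fst w)) (snd (fst w)))\<^sup>2) \<partial>Q) \<le> ennreal (t\<^sup>2 * w + e)"
  proof -
    note [measurable] = coupling_space(6,7)[OF q1]
    have "transport_cost (distr Q q1 fst) \<le> ennreal (t\<^sup>2 * w + e)" using c1 Q(2) by simp
    then show ?thesis unfolding transport_cost_def by (subst (asm) nn_integral_distr[OF mQ(1)]) auto
  qed
  have cost2: "(\<integral>\<^sup>+w. ennreal ((dist (fst (snd w)) (snd (snd w)))\<^sup>2) \<partial>Q) \<le> ennreal ((1 - t)\<^sup>2 * w + e)"
  proof -
    note [measurable] = coupling_space(6,7)[OF q2]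
    have "transport_cost (distr Q q2 snd) \<le> ennreal ((1 - t)\<^sup>2 * w + e)" using c2 Q(3) by simp
    then show ?thesis unfolding transport_cost_def by (subst (asm) nn_integral_distr[OF mQ(2)]) auto
  qed
  \<comment> \<open>R bounds the distance between the end points, as both are near x. A middle point
    farther than tR + \<delta> + s from x thus overshoots its share by at least s, where \<delta>
    accounts for the starting point.\<close>
  define R where "R = \<epsilon> + \<delta>"
  have R: "0 \<le> R" using assms by (simp add: R_def)
  have split: "ennreal (p * y + (p' * y' + r)) = ennreal p * ennreal y + (ennreal p' * ennreal y' + ennreal r)"
    if "0 \<le> p" "0 \<le> y" "0 \<le> p'" "0 \<le> y'" "0 \<le> r" for p y p' y' r
    using that by (simp add: ennreal_mult)
  have split': "ennreal (y + p * indicator B z) = ennreal y + ennreal p * indicator B z"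
    if "0 \<le> p" "0 \<le> y" for p y B and z :: "('a \<times> 'a) \<times> ('a \<times> 'a)"
    using that by (auto simp: indicator_def)
  let ?D = "\<lambda>w. dist (fst (fst w)) (snd (snd w))"
  let ?a = "\<lambda>w. dist (fst (fst w)) (snd (fst w))"
  let ?b = "\<lambda>w. dist (fst (snd w)) (snd (snd w))"
  let ?P = "{w \<in> space Q. t * R + \<delta> + s < dist x (snd (fst w))}"
  have [measurable]: "?P \<in> sets Q" by measurable
  have ae0: "AE w in Q. dist x (fst (fst w)) \<le> \<delta>"
    using supp(1) unfolding d0[symmetric] by (subst (asm) AE_distr_iff) auto
  have ae1: "AE w in Q. dist x (snd (snd w)) \<le> \<epsilon>"
    using supp(2) unfolding d1[symmetric] by (subst (asm) AE_distr_iff) auto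
  have "ennreal w + ennreal (s\<^sup>2 / t) * emeasure Q ?P
      \<le> (\<integral>\<^sup>+w. ennreal ((?D w)\<^sup>2) \<partial>Q) + (\<integral>\<^sup>+w. ennreal (s\<^sup>2 / t) * indicator ?P w \<partial>Q)"
    using cost by (subst nn_integral_cmult_indicator) (auto intro: add_right_mono)
  also have "\<dots> = (\<integral>\<^sup>+w. ennreal ((?D w)\<^sup>2) + ennreal (s\<^sup>2 / t) * indicator ?P w \<partial>Q)"
    by (rule nn_integral_add[symmetric]) auto
  also have "\<dots> \<le> (\<integral>\<^sup>+w. ennreal (1 / t) * ennreal ((?a w)\<^sup>2) + (ennreal (1 / (1 - t)) * ennreal ((?b w)\<^sup>2) + ennreal (2 * e * R)) \<partial>Q)"
  proof (intro nn_integral_mono_AE, use Qe ae0 ae1 in eventually_elim)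
    fix w :: "('a \<times> 'a) \<times> ('a \<times> 'a)"
    assume h: "dist (snd (fst w)) (fst (snd w)) < e" "dist x (fst (fst w)) \<le> \<delta>" "dist x (snd (snd w)) \<le> \<epsilon>"
    have DR: "?D w \<le> R" using h dist_triangle3[of "fst (fst w)" "snd (snd w)" x] by (simp add: R_def)
    have "?D w \<le> ?a w + dist (snd (fst w)) (snd (snd w))" by (rule dist_triangle)
    moreover have "dist (snd (fst w)) (snd (snd w)) \<le> dist (snd (fst w)) (fst (snd w)) + ?b w" by (rule dist_triangle)
    ultimately have "?D w \<le> ?a w + ?b w + e" using h by linarith
    then have g: "(?D w)\<^sup>2 + (if t * ?D w + s \<le> ?a w then s\<^sup>2 / t else 0) \<le> (?a w)\<^sup>2 / t + (?b w)\<^sup>2 / (1 - t) + 2 * e * R"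
      using DR assms by (intro intermediate_cost_gap) auto
    have "t * ?D w + s \<le> ?a w" if "t * R + \<delta> + s < dist x (snd (fst w))"
    proof -
      have "t * ?D w \<le> t * R" using DR t by simp
      moreover have "dist x (snd (fst w)) \<le> dist x (fst (fst w)) + ?a w" by (rule dist_triangle)
      ultimately show ?thesis using that h by linarith
    qed
    then have "s\<^sup>2 / t * indicator ?P w \<le> (if t * ?D w + s \<le> ?a w then s\<^sup>2 / t else 0)"
      using t by (auto simp: indicator_def)
    then have le: "(?D w)\<^sup>2 + s\<^sup>2 / t * indicator ?P w \<le> 1 / t * (?a w)\<^sup>2 + (1 / (1 - t) * (?b w)\<^sup>2 + 2 * e * R)"
      using g by simp
    have nn: "0 \<le> s\<^sup>2 / t" "0 \<le> (?D w)\<^sup>2" "0 \<le> 1 / t" "0 \<le> (?a w)\<^sup>2"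
        "0 \<le> 1 / (1 - t)" "0 \<le> (?b w)\<^sup>2" "0 \<le> 2 * e * R"
      using t R \<open>0 < e\<close> by auto
    from le have "ennreal ((?D w)\<^sup>2 + s\<^sup>2 / t * indicator ?P w) \<le> ennreal (1 / t * (?a w)\<^sup>2 + (1 / (1 - t) * (?b w)\<^sup>2 + 2 * e * R))"
      by (rule ennreal_leI)
    then show "ennreal ((?D w)\<^sup>2) + ennreal (s\<^sup>2 / t) * indicator ?P w
        \<le> ennreal (1 / t) * ennreal ((?a w)\<^sup>2) + (ennreal (1 / (1 - t)) * ennreal ((?b w)\<^sup>2) + ennreal (2 * e * R))"
      by (simp only: split'[OF nn(1,2)] split[OF nn(3-7)])
  qed
  also have "\<dots> = ennreal (1 / t) * (\<integral>\<^sup>+w. ennreal ((?a w)\<^sup>2) \<partial>Q) + (ennreal (1 / (1 - t)) * (\<integral>\<^sup>+w. ennreal ((?b w)\<^sup>2) \<partial>Q) + ennreal (2 * e * R))"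
    by (simp add: nn_integral_add nn_integral_cmult Q.emeasure_space_1)
  also have "\<dots> \<le> ennreal (1 / t) * ennreal (t\<^sup>2 * w + e) + (ennreal (1 / (1 - t)) * ennreal ((1 - t)\<^sup>2 * w + e) + ennreal (2 * e * R))"
    by (intro add_mono mult_left_mono cost1 cost2) auto
  also have "\<dots> = ennreal (1 / t * (t\<^sup>2 * w + e) + (1 / (1 - t) * ((1 - t)\<^sup>2 * w + e) + 2 * e * R))"
    using t R W(2) \<open>0 < e\<close> by (subst split) auto
  \<comment> \<open>The weights return t w + (1 - t) w = w, which is finite and cancels from both
    sides.\<close>
  also have "1 / t * (t\<^sup>2 * w + e) + (1 / (1 - t) * ((1 - t)\<^sup>2 * w + e) + 2 * e * R) = w + e * (1 / t + 1 / (1 - t) + 2 * R)"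
    using t by (simp add: field_simps power2_eq_square)
  also have "ennreal \<dots> = ennreal w + ennreal (e * (1 / t + 1 / (1 - t) + 2 * R))"
    using t assms by (intro ennreal_plus) (auto simp: R_def)
  finally have "ennreal (s\<^sup>2 / t) * emeasure Q ?P \<le> ennreal (e * (1 / t + 1 / (1 - t) + 2 * R))"
    by (simp add: ennreal_add_left_cancel_le)
  then have "ennreal (s\<^sup>2 / t * measure Q ?P) \<le> ennreal (e * (1 / t + 1 / (1 - t) + 2 * R))"
    using t by (subst ennreal_mult) (auto simp: Q.emeasure_eq_measure)
  then have "s\<^sup>2 / t * measure Q ?P \<le> e * (1 / t + 1 / (1 - t) + 2 * R)"
    using t assms by (subst (asm) ennreal_le_iff) (auto simp: R_def)
  then have "measure Q ?P \<le> e * (1 / t + 1 / (1 - t) + 2 * R) * t / s\<^sup>2"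
    using t \<open>0 < s\<close> by (simp add: field_simps)
  moreover have "emeasure \<nu> (UNIV - cball x (t * R + \<delta> + s)) = emeasure Q ?P"
    unfolding d[symmetric] by (subst emeasure_distr) (auto intro!: arg_cong[where f="emeasure Q"])
  ultimately show ?thesis by (simp add: R_def Q.emeasure_eq_measure ennreal_leI)
qed

text \<open>The tail bound is linear in e while the tail itself does not depend on e, so it has
  measure zero for each fixed s > 0.\<close>

lemma intermediate_measure_concentrated:
  fixes \<nu>0 \<nu> \<nu>1 :: "'a::{metric_space,second_countable_topology} measure"
  assumes "W2sq \<nu>0 \<nu>1 = ennreal w" "0 \<le> w"
    "W2sq \<nu>0 \<nu> = ennreal (t\<^sup>2 * w)" "W2sq \<nu> \<nu>1 = ennreal ((1 - t)\<^sup>2 * w)"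
    and t: "0 < t" "t < 1" and "0 \<le> \<epsilon>" "0 \<le> \<delta>" "0 < s"
    and "AE y in \<nu>0. dist x y \<le> \<delta>" "AE y in \<nu>1. dist x y \<le> \<epsilon>"
  shows "emeasure \<nu> (UNIV - cball x (t * (\<epsilon> + \<delta>) + \<delta> + s)) = 0" (is "?m = 0")
proof -
  define C where "C = (1 / t + 1 / (1 - t) + 2 * (\<epsilon> + \<delta>)) * t / s\<^sup>2"
  have "C > 0" using assms by (auto simp: C_def intro!: divide_pos_pos mult_pos_pos add_pos_nonneg)
  have "?m \<le> 0 + ennreal e" if "0 < e" for e
  proof -
    have "?m \<le> ennreal (e / C * (1 / t + 1 / (1 - t) + 2 * (\<epsilon> + \<delta>)) * t / s\<^sup>2)"
      using that \<open>C > 0\<close> by (intro intermediate_measure_tail[OF assms]) auto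
    also have "e / C * (1 / t + 1 / (1 - t) + 2 * (\<epsilon> + \<delta>)) * t / s\<^sup>2 = e / C * C"
      unfolding C_def by (simp add: mult.assoc)
    also have "\<dots> = e" using \<open>C > 0\<close> by simp
    finally show ?thesis by simp
  qed
  then have "?m \<le> 0" by (rule ennreal_le_epsilon)
  then show ?thesis by simp
qed

subsection \<open>Entropy and distortion estimates\<close>

text \<open>Hoelder's inequality as a pointwise weighted arithmetic-geometric mean: \<rho> x is
  compared with 1/b, the uniform density on B, for which equality holds. The total mass is only
  bounded by 1 because in the application a singular part may carry the rest.\<close>

lemma nn_integral_powr_le:
  assumes [measurable]: "\<rho> \<in> borel_measurable M" "B \<in> sets M" and nonneg: "\<And>x. 0 \<le> \<rho> x"
    and B: "emeasure M B = ennreal b" "0 < b"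
    and supp: "AE x in M. x \<notin> B \<longrightarrow> \<rho> x = 0"
    and total: "(\<integral>\<^sup>+x. ennreal (\<rho> x) \<partial>M) \<le> 1"
    and "1 \<le> N"
  shows "(\<integral>\<^sup>+x. ennreal (\<rho> x powr (1 - 1 / N)) \<partial>M) \<le> ennreal (b powr (1 / N))"
proof -
  define \<alpha> where "\<alpha> = 1 - 1 / N"
  have \<alpha>: "0 \<le> \<alpha>" "0 \<le> 1 - \<alpha>" "1 - \<alpha> = 1 / N" using \<open>1 \<le> N\<close> by (auto simp: \<alpha>_def)
  have young: "\<rho> x powr \<alpha> \<le> b powr (1 / N) * \<alpha> * \<rho> x + b powr (1 / N) * (1 - \<alpha>) / b" for x
  proof -
    have "\<rho> x powr \<alpha> * (1 / b) powr (1 - \<alpha>) \<le> \<alpha> * \<rho> x + (1 - \<alpha>) * (1 / b)"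
      using \<alpha> B nonneg[of x] Youngs_inequality_0[of \<alpha> "1 - \<alpha>" "\<rho> x" "1 / b"]
      by (cases "\<rho> x = 0") auto
    then have "b powr (1 / N) * (\<rho> x powr \<alpha> * (1 / b) powr (1 - \<alpha>)) \<le> b powr (1 / N) * (\<alpha> * \<rho> x + (1 - \<alpha>) * (1 / b))"
      by (intro mult_left_mono) auto
    moreover have "b powr (1 / N) * (\<rho> x powr \<alpha> * (1 / b) powr (1 - \<alpha>)) = \<rho> x powr \<alpha>"
      unfolding \<alpha>(3) using B(2) by (simp add: powr_divide)
    ultimately have "\<rho> x powr \<alpha> \<le> b powr (1 / N) * (\<alpha> * \<rho> x + (1 - \<alpha>) * (1 / b))" by simp
    then show ?thesis by (simp add: distrib_left mult.assoc)
  qed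
  have "(\<integral>\<^sup>+x. ennreal (\<rho> x powr \<alpha>) \<partial>M)
      \<le> (\<integral>\<^sup>+x. ennreal (b powr (1 / N) * \<alpha>) * ennreal (\<rho> x) + ennreal (b powr (1 / N) * (1 - \<alpha>) / b) * indicator B x \<partial>M)"
  proof (intro nn_integral_mono_AE, use supp in eventually_elim)
    fix x assume x: "x \<notin> B \<longrightarrow> \<rho> x = 0"
    show "ennreal (\<rho> x powr \<alpha>) \<le> ennreal (b powr (1 / N) * \<alpha>) * ennreal (\<rho> x) + ennreal (b powr (1 / N) * (1 - \<alpha>) / b) * indicator B x"
    proof (cases "x \<in> B")
      case True
      have "ennreal (\<rho> x powr \<alpha>) \<le> ennreal (b powr (1 / N) * \<alpha> * \<rho> x + b powr (1 / N) * (1 - \<alpha>) / b)"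
        using young by (rule ennreal_leI)
      also have "\<dots> = ennreal (b powr (1 / N) * \<alpha> * \<rho> x) + ennreal (b powr (1 / N) * (1 - \<alpha>) / b)"
        using \<alpha> B nonneg[of x] by (intro ennreal_plus) auto
      also have "ennreal (b powr (1 / N) * \<alpha> * \<rho> x) = ennreal (b powr (1 / N) * \<alpha>) * ennreal (\<rho> x)"
        using \<alpha> nonneg[of x] by (intro ennreal_mult) auto
      finally show ?thesis using True by simp
    qed (use x in simp)
  qed
  also have "\<dots> = ennreal (b powr (1 / N) * \<alpha>) * (\<integral>\<^sup>+x. ennreal (\<rho> x) \<partial>M) + ennreal (b powr (1 / N) * (1 - \<alpha>) / b) * ennreal b"
    by (simp add: nn_integral_add nn_integral_cmult B(1)[symmetric])
  also have "\<dots> \<le> ennreal (b powr (1 / N) * \<alpha>) * 1 + ennreal (b powr (1 / N) * (1 - \<alpha>) / b) * ennreal b"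
    using total by (intro add_right_mono mult_left_mono) auto
  also have "ennreal (b powr (1 / N) * (1 - \<alpha>) / b) * ennreal b = ennreal (b powr (1 / N) * (1 - \<alpha>))"
    using \<alpha> B(2) by (subst ennreal_mult[symmetric]) auto
  also have "ennreal (b powr (1 / N) * \<alpha>) * 1 + ennreal (b powr (1 / N) * (1 - \<alpha>)) = ennreal (b powr (1 / N) * \<alpha> + b powr (1 / N) * (1 - \<alpha>))"
    using \<alpha> by (subst ennreal_plus) auto
  also have "b powr (1 / N) * \<alpha> + b powr (1 / N) * (1 - \<alpha>) = b powr (1 / N)" by (simp add: algebra_simps)
  finally show ?thesis by (simp add: \<alpha>_def)
qed

text \<open>The exponential form is chosen because \<open>tau\<close> raises a ratio of sines to the
  power 1 - 1/N, which then merely scales the exponent. Taylor polynomials truncated on the right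
  side are compared.\<close>

lemma sin_le_mult_exp:
  fixes x :: real
  assumes "0 \<le> x" "x \<le> 1"
  shows "sin x \<le> x * exp (- (x\<^sup>2 / 6))"
proof -
  have "(\<Sum>m<5. sin_coeff m * x ^ m) = x - x ^ 3 / 6"
  proof -
    have "{..<5} = {0, 1, 2, 3, 4::nat}" by auto
    then show ?thesis by (simp add: sin_coeff_def fact_numeral)
  qed
  then have "sin x \<le> x - x ^ 3 / 6 + x ^ 5 / 120"
    using abs_le_D1[OF Maclaurin_sin_bound[of x 5]] assms by (simp add: fact_numeral)
  \<comment> \<open>With y = x^2/6 the bracket is the cubic Taylor polynomial of exp(-y). Since x^7
    \<le> x^5, the comparison rests on 1/120 \<le> 1/72 - 1/1296.\<close>
  also have "\<dots> \<le> x * (1 - x\<^sup>2 / 6 + (x\<^sup>2 / 6)\<^sup>2 / 2 - (x\<^sup>2 / 6) ^ 3 / 6)"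
  proof -
    have "x ^ 7 \<le> x ^ 5" using assms by (intro power_decreasing) auto
    moreover have "0 \<le> x ^ 5" using assms by simp
    ultimately show ?thesis by (simp add: eval_nat_numeral field_simps)
  qed
  also have "\<dots> \<le> x * exp (- (x\<^sup>2 / 6))"
  proof (intro mult_left_mono)
    obtain u where "exp (- (x\<^sup>2 / 6)) = (\<Sum>m<4. (- (x\<^sup>2 / 6)) ^ m / fact m) + exp u / fact 4 * (- (x\<^sup>2 / 6)) ^ 4"
      using Maclaurin_exp_le[of "- (x\<^sup>2 / 6)" 4] by blast
    moreover have "0 \<le> exp u / fact 4 * (- (x\<^sup>2 / 6)) ^ 4" by simp
    ultimately have "(\<Sum>m<4. (- (x\<^sup>2 / 6)) ^ m / fact m) \<le> exp (- (x\<^sup>2 / 6))" by linarith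
    moreover have "(\<Sum>m<4. (- (x\<^sup>2 / 6)) ^ m / fact m) = 1 - x\<^sup>2 / 6 + (x\<^sup>2 / 6)\<^sup>2 / 2 - (x\<^sup>2 / 6) ^ 3 / 6"
      by (simp add: eval_nat_numeral fact_numeral field_simps)
    ultimately show "1 - x\<^sup>2 / 6 + (x\<^sup>2 / 6)\<^sup>2 / 2 - (x\<^sup>2 / 6) ^ 3 / 6 \<le> exp (- (x\<^sup>2 / 6))" by simp
  qed (use assms in auto)
  finally show ?thesis .
qed

text \<open>The denominator contributes exp(x^2/6). The factor 1 - t^2 absorbs the cubic error of
  sin(tx) and costs nothing in the limit t to 0.\<close>

lemma sin_ratio_ge:
  fixes x t :: real
  assumes "0 < x" "x \<le> 1" "0 < t" "t < 1"
  shows "t * (1 - t\<^sup>2) * exp (x\<^sup>2 / 6) \<le> sin (t * x) / sin x"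
proof -
  have x: "0 < sin x" using assms pi_gt3 by (intro sin_gt_zero) auto
  have "t * (1 - t\<^sup>2) * exp (x\<^sup>2 / 6) * sin x \<le> t * (1 - t\<^sup>2) * exp (x\<^sup>2 / 6) * (x * exp (- (x\<^sup>2 / 6)))"
    using assms by (intro mult_left_mono sin_le_mult_exp) (auto simp: power_le_one)
  also have "\<dots> = t * x - (t * x) * t\<^sup>2" by (simp add: exp_minus field_simps)
  also have "\<dots> \<le> t * x - (t * x) ^ 3 / 6"
  proof -
    have "(t * x) ^ 3 = (t * x) * t\<^sup>2 * x\<^sup>2" by (simp add: eval_nat_numeral)
    also have "\<dots> \<le> (t * x) * t\<^sup>2 * 1" using assms by (intro mult_left_mono) (auto simp: power_le_one)
    finally have "(t * x) ^ 3 \<le> (t * x) * t\<^sup>2" by simp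
    moreover have "0 \<le> (t * x) * t\<^sup>2" using assms by simp
    ultimately show ?thesis by linarith
  qed
  also have "\<dots> \<le> sin (t * x)"
  proof -
    have "{..<3} = {0, 1, 2::nat}" by auto
    then have "(\<Sum>m<3. sin_coeff m * (t * x) ^ m) = t * x" by (simp add: sin_coeff_def)
    moreover have "\<bar>t * x\<bar> = t * x" using assms by simp
    ultimately have "\<bar>sin (t * x) - t * x\<bar> \<le> (t * x) ^ 3 / 6"
      using Maclaurin_sin_bound[of "t * x" 3] by (simp add: fact_numeral)
    then show ?thesis by linarith
  qed
  finally show ?thesis using x by (simp add: field_simps)
qed

text \<open>With x^2 = K d^2/(N - 1) and the exponent p = (N - 1)/N of \<open>tau\<close>, the
  number N - 1 cancels in p x^2/6 = K d^2/(6N); this is the origin of \<kappa>/(6n). The condition K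
  d^2 \<le> 1 keeps \<open>tau\<close> in its finite branch and x below 1, and the powers t^(1/N)
  and t^p combine to t.\<close>

lemma tau_ge:
  fixes N :: real
  assumes "0 \<le> K" "2 \<le> N" and t: "0 < t" "t < 1" and "0 \<le> d" "K * d\<^sup>2 \<le> 1"
  shows "ennreal (t * (1 - t\<^sup>2) * (1 + K / (6 * N) * d\<^sup>2)) \<le> tau K N t d"
proof -
  have "1 < pi\<^sup>2" using pi_gt3 by (simp add: one_less_power)
  then have "1 * 1 < (N - 1) * pi\<^sup>2" using assms by (intro mult_le_less_imp_less) auto
  then have less: "\<not> K * d\<^sup>2 \<ge> (N - 1) * pi\<^sup>2" using assms by linarith
  define p where "p = 1 - 1 / N"
  have p: "0 \<le> p" "p \<le> 1" using assms by (auto simp: p_def)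
  have tp: "t powr (1 / N) * t powr p = t" using t by (simp add: powr_add[symmetric] p_def)
  have t2: "0 < 1 - t\<^sup>2" "1 - t\<^sup>2 \<le> 1" using t by (auto simp: power_less_one_iff abs_square_less_1)
  have "t * (1 - t\<^sup>2) * (1 + K / (6 * N) * d\<^sup>2) \<le> t powr (1 / N) * sigma_fin K (N - 1) t d powr p"
  proof (cases "K * d\<^sup>2 = 0")
    case True
    then have "sigma_fin K (N - 1) t d = t" unfolding sigma_fin_def by (simp only: if_True if_False less_irrefl refl)
    moreover have "K / (6 * N) * d\<^sup>2 = 0" using True by simp
    moreover have "t * (1 - t\<^sup>2) \<le> t" using t t2 by (intro mult_left_le) auto
    ultimately show ?thesis using tp by (simp only: add_0_right mult_1_right)
  next
    case False
    then have Kd: "0 < K * d\<^sup>2" "0 < K" "0 < d" using assms by (auto simp: less_le)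
    define x where "x = d * sqrt (K / (N - 1))"
    have x2: "x\<^sup>2 = K * d\<^sup>2 / (N - 1)" using assms by (simp add: x_def power_mult_distrib)
    also have "\<dots> \<le> 1" using assms by simp
    finally have x: "0 < x" "x \<le> 1" using Kd assms by (auto simp: x_def abs_square_le_1)
    have "sigma_fin K (N - 1) t d = sin (t * x) / sin x"
      using Kd by (simp add: sigma_fin_def x_def mult.assoc)
    then have "t * (1 - t\<^sup>2) * exp (x\<^sup>2 / 6) \<le> sigma_fin K (N - 1) t d"
      using sin_ratio_ge[OF x t] by simp
    then have "(t * (1 - t\<^sup>2) * exp (x\<^sup>2 / 6)) powr p \<le> sigma_fin K (N - 1) t d powr p"
      using t t2 p by (intro powr_mono2) auto
    also have "(t * (1 - t\<^sup>2) * exp (x\<^sup>2 / 6)) powr p = t powr p * (1 - t\<^sup>2) powr p * exp (p * (x\<^sup>2 / 6))"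
      using t t2 by (simp add: powr_mult exp_powr_real mult.commute)
    finally have "t powr (1 / N) * (t powr p * (1 - t\<^sup>2) powr p * exp (p * (x\<^sup>2 / 6))) \<le> t powr (1 / N) * sigma_fin K (N - 1) t d powr p"
      by (intro mult_left_mono) auto
    moreover have "t powr (1 / N) * (t powr p * (1 - t\<^sup>2) powr p * exp (p * (x\<^sup>2 / 6))) = t * ((1 - t\<^sup>2) powr p * exp (p * (x\<^sup>2 / 6)))"
      using tp by (simp add: mult.assoc[symmetric])
    moreover have "t * ((1 - t\<^sup>2) * (1 + K / (6 * N) * d\<^sup>2)) \<le> t * ((1 - t\<^sup>2) powr p * exp (p * (x\<^sup>2 / 6)))"
    proof (intro mult_left_mono mult_mono)
      show "1 - t\<^sup>2 \<le> (1 - t\<^sup>2) powr p" using powr_mono'[of p 1 "1 - t\<^sup>2"] p t2 by simp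
      have "p * (x\<^sup>2 / 6) = K / (6 * N) * d\<^sup>2" unfolding x2 p_def using assms by (simp add: field_simps)
      then show "1 + K / (6 * N) * d\<^sup>2 \<le> exp (p * (x\<^sup>2 / 6))" by (simp only: exp_ge_add_one_self)
    qed (use t t2 assms in auto)
    ultimately have "t * ((1 - t\<^sup>2) * (1 + K / (6 * N) * d\<^sup>2)) \<le> t powr (1 / N) * sigma_fin K (N - 1) t d powr p"
      by linarith
    then show ?thesis by (simp only: mult.assoc)
  qed
  then show ?thesis using less unfolding tau_def p_def by (simp add: ennreal_leI)
qed

subsection \<open>The curvature-dimension inequality for uniform measures\<close>

text \<open>Balls of finite measure cover the space, and by Lindelof countably many of them
  suffice.\<close>

lemma mm_space_sigma_finite:
  fixes \<mu> :: "('a::polish_space) measure"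
  assumes "mm_space \<mu>"
  shows "sigma_finite_measure \<mu>"
proof
  define F where "F = {ball x r | (x::'a) r. emeasure \<mu> (ball x r) < \<infinity>}"
  have sets: "sets \<mu> = sets borel" and fin: "\<And>x. \<exists>r>0. emeasure \<mu> (ball x r) < \<infinity>"
    using assms by (auto simp: mm_space_def)
  have "\<Union>F = UNIV"
  proof -
    have "x \<in> \<Union>F" for x
    proof -
      obtain r where "0 < r" "emeasure \<mu> (ball x r) < \<infinity>" using fin by blast
      then have "ball x r \<in> F" "x \<in> ball x r" by (auto simp: F_def)
      then show ?thesis by blast
    qed
    then show ?thesis by blast
  qed
  have F: "open S" "emeasure \<mu> S \<noteq> \<infinity>" if "S \<in> F" for S
    using that by (auto simp: F_def)
  obtain F' where F': "F' \<subseteq> F" "countable F'" "\<Union>F' = \<Union>F"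
    using Lindelof[of F] F(1) by blast
  show "\<exists>A. countable A \<and> A \<subseteq> sets \<mu> \<and> \<Union>A = space \<mu> \<and> (\<forall>a\<in>A. emeasure \<mu> a \<noteq> \<infinity>)"
  proof (intro exI[of _ F'] conjI ballI)
    show "F' \<subseteq> sets \<mu>" 
      unfolding sets using F'(1) F(1) borel_open by (intro subsetI) blast
    show "\<Union>F' = space \<mu>" using F' \<open>\<Union>F = UNIV\<close> sets_eq_imp_space_eq[OF sets] by simp
    show "emeasure \<mu> S \<noteq> \<infinity>" if "S \<in> F'" for S using F' F(2) that by blast
  qed fact
qed

lemma AE_uniform_measure_mem:
  "A \<in> sets M \<Longrightarrow> AE y in uniform_measure M A. y \<in> A"
  by (rule AE_uniform_measureI) auto

lemma Pinf_uniform_measure: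
  fixes \<mu> :: "'a::metric_space measure"
  assumes "sets \<mu> = sets borel" "A \<in> sets borel" "A \<subseteq> cball x r" "emeasure \<mu> A \<noteq> 0" "emeasure \<mu> A \<noteq> \<infinity>"
  shows "Pinf \<mu> (uniform_measure \<mu> A)"
proof -
  interpret prob_space "uniform_measure \<mu> A"
    using assms by (intro prob_space_uniform_measure) auto
  have AE: "AE y in uniform_measure \<mu> A. y \<in> A"
    using assms by (intro AE_uniform_measure_mem) auto
  have "(\<integral>\<^sup>+y. ennreal ((dist x y)\<^sup>2) \<partial>uniform_measure \<mu> A) \<le> (\<integral>\<^sup>+y. ennreal (r\<^sup>2) \<partial>uniform_measure \<mu> A)"
    using AE by (intro nn_integral_mono_AE, eventually_elim)
       (use assms in \<open>auto intro!: ennreal_leI power_mono\<close>)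
  also have "\<dots> < \<infinity>" using emeasure_space_1 by (simp add: ennreal_mult_less_top)
  finally have "(\<integral>\<^sup>+y. ennreal ((dist x y)\<^sup>2) \<partial>uniform_measure \<mu> A) < \<infinity>" .
  then have "P2 (uniform_measure \<mu> A)"
    using assms prob_space_axioms by (auto simp: P2_def)
  moreover have "absolutely_continuous \<mu> (uniform_measure \<mu> A)"
    unfolding uniform_measure_def using assms
    by (intro absolutely_continuousI_density borel_measurable_divide_ennreal) auto
  moreover have "emeasure (uniform_measure \<mu> A) (UNIV - A) = 0"
    using assms by (subst emeasure_uniform_measure) (auto simp: Int_Diff)
  moreover have "bounded A" using assms bounded_subset bounded_cball by blast
  ultimately show ?thesis using assms unfolding Pinf_def by blast
qed

lemma RN_deriv_uniform_measure:
  assumes "A \<in> sets M" "emeasure M A = ennreal m" "0 < m"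
  shows "AE y in uniform_measure M A. RN_deriv M (uniform_measure M A) y = ennreal (1 / m)"
proof -
  have [measurable]: "A \<in> sets M" by fact
  interpret prob_space "uniform_measure M A"
    using assms by (intro prob_space_uniform_measure) auto
  have "AE y in M. indicator A y / emeasure M A = RN_deriv M (uniform_measure M A) y"
    by (rule RN_deriv_unique_sigma_finite)
       (auto simp: uniform_measure_def[symmetric] sigma_finite_measure_axioms)
  then have "AE y in M. y \<in> A \<longrightarrow> RN_deriv M (uniform_measure M A) y = ennreal (1 / m)"
  proof eventually_elim
    case (elim y)
    have "1 / ennreal m = ennreal (1 / m)" using divide_ennreal[of 1 m] assms by simp
    with elim show ?case by (auto simp: assms(2))
  qed
  then show ?thesis by (rule AE_uniform_measureI[OF assms(1)])
qed

lemma nn_integral_uniform_measure_real: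
  assumes [measurable]: "A \<in> sets M" "f \<in> borel_measurable M" and "emeasure M A = ennreal m" "0 < m"
    and "(\<integral>\<^sup>+y. f y * indicator A y \<partial>M) = ennreal I" "0 \<le> I"
  shows "(\<integral>\<^sup>+y. f y \<partial>uniform_measure M A) = ennreal (I / m)"
proof -
  have "(\<integral>\<^sup>+y. f y \<partial>uniform_measure M A) = (\<integral>\<^sup>+y. f y * indicator A y \<partial>M) / emeasure M A"
    by (rule nn_integral_uniform_measure) fact+
  also have "\<dots> = ennreal (I / m)"
    unfolding assms(3,5) using assms(4,6) by (rule divide_ennreal[rotated])
  finally show ?thesis .
qed

text \<open>In the application d is the distance to the centre x and D the distance to a starting
  point within \<delta> of x; exchanging them costs 2\<delta>\<epsilon>, which vanishes with
  \<delta>.\<close>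

lemma square_le_perturbed:
  fixes d D \<delta> \<epsilon> :: real
  assumes "0 \<le> d" "d \<le> \<epsilon>" "0 \<le> \<delta>" "d \<le> D + \<delta>"
  shows "d\<^sup>2 \<le> D\<^sup>2 + 2 * \<delta> * \<epsilon>"
proof (cases "d \<le> \<delta>")
  case True
  have "d * d \<le> \<delta> * \<epsilon>" using True assms by (intro mult_mono) auto
  moreover have "0 \<le> \<delta> * \<epsilon>" using assms by simp
  moreover have "0 \<le> D\<^sup>2" by simp
  ultimately show ?thesis unfolding power2_eq_square by linarith
next
  case False
  then have "(d - \<delta>)\<^sup>2 \<le> D\<^sup>2" using assms by (intro power_mono) auto
  moreover have "\<delta> * d \<le> \<delta> * \<epsilon>" using assms by (intro mult_left_mono) auto
  moreover have "(d - \<delta>)\<^sup>2 = d\<^sup>2 - 2 * (\<delta> * d) + \<delta>\<^sup>2" by (simp add: power2_eq_square algebra_simps)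
  moreover have "0 \<le> \<delta>\<^sup>2" by simp
  ultimately show ?thesis by linarith
qed

text \<open>This is the CD inequality at time t with N' = n, from the uniform measure on the
  \<delta>-ball to that on A. The target density 1/m yields m^(1/n), \<open>tau_ge\<close> bounds
  the distortion at the target, the start contributes at least 0, and concentration with Hoelder
  bounds the entropy by b^(1/n). The error term stands on the right so that nothing is subtracted in
  \<open>ennreal\<close>.\<close>

lemma CD_volume_step:
  fixes \<mu> :: "('a::polish_space) measure" and n :: nat and \<kappa> :: real
  assumes n: "2 \<le> n" and \<kappa>: "0 \<le> \<kappa>" and \<mu>: "sets \<mu> = sets borel" and CD: "CD \<kappa> (real n) \<mu>"
    and A: "A \<in> sets borel" "A \<subseteq> cball x \<epsilon>" and m: "emeasure \<mu> A = ennreal m" "0 < m"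
    and I: "(\<integral>\<^sup>+y. ennreal ((dist x y)\<^sup>2) * indicator A y \<partial>\<mu>) = ennreal I" "0 \<le> I"
    and \<delta>: "0 < \<delta>" "emeasure \<mu> (cball x \<delta>) \<noteq> 0" "emeasure \<mu> (cball x \<delta>) \<noteq> \<infinity>"
    and \<epsilon>: "0 < \<epsilon>" "\<kappa> * (\<epsilon> + \<delta>)\<^sup>2 \<le> 1"
    and t: "0 < t" "t < 1" and s: "0 < s"
    and b: "emeasure \<mu> (cball x (t * (\<epsilon> + \<delta>) + \<delta> + s)) = ennreal b" "0 < b"
  defines "c \<equiv> \<kappa> / (6 * real n)"
  shows "t * (1 - t\<^sup>2) * m powr (1 / real n) * (1 + c * (I / m))
     \<le> b powr (1 / real n) + t * (1 - t\<^sup>2) * m powr (1 / real n) * (c * (2 * \<delta> * \<epsilon>))"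
proof -
  define \<nu>0 where "\<nu>0 = uniform_measure \<mu> (cball x \<delta>)"
  define \<nu>1 where "\<nu>1 = uniform_measure \<mu> A"
  define r where "r = t * (\<epsilon> + \<delta>) + \<delta> + s"
  define N where "N = real n"
  have Pinf: "Pinf \<mu> \<nu>0" "Pinf \<mu> \<nu>1"
    unfolding \<nu>0_def \<nu>1_def using assms by (auto intro!: Pinf_uniform_measure)
  obtain q G where q: "optimal_coupling \<nu>0 \<nu>1 q" and G: "W2_geodesic G \<nu>0 \<nu>1"
    and H: "\<forall>t\<in>{0..1}. \<forall>N'\<ge>N.
          (\<exists>\<rho> \<nu>s. \<rho> \<in> borel_measurable borel \<and> (\<forall>x. \<rho> x \<ge> 0) \<and> sets \<nu>s = sets borel \<and>
             (\<exists>Z\<in>sets borel. emeasure \<mu> Z = 0 \<and> emeasure \<nu>s (UNIV - Z) = 0) \<and>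
             (\<forall>A\<in>sets borel. emeasure (G t) A = emeasure (density \<mu> (\<lambda>x. ennreal (\<rho> x))) A + emeasure \<nu>s A) \<and>
             (\<integral>\<^sup>+p. tau \<kappa> N' (1 - t) (dist (fst p) (snd p)) *
                       ennreal (enn2real (RN_deriv \<mu> \<nu>0 (fst p)) powr (- 1 / N'))
                   + tau \<kappa> N' t (dist (fst p) (snd p)) *
                       ennreal (enn2real (RN_deriv \<mu> \<nu>1 (snd p)) powr (- 1 / N')) \<partial>q)
             \<le> (\<integral>\<^sup>+x. ennreal (\<rho> x powr (1 - 1 / N')) \<partial>\<mu>))"
    using CD[unfolded CD_def, rule_format, OF conjI[OF Pinf], folded N_def]
    by (elim exE conjE) (rule that; assumption)
  have tin: "t \<in> {0..1}" using t by simp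
  obtain \<rho> \<nu>s where [measurable]: "\<rho> \<in> borel_measurable borel" and \<rho>': "\<forall>x. \<rho> x \<ge> 0"
    and dec': "\<forall>A\<in>sets borel. emeasure (G t) A = emeasure (density \<mu> (\<lambda>x. ennreal (\<rho> x))) A + emeasure \<nu>s A"
    and ineq: "(\<integral>\<^sup>+p. tau \<kappa> N (1 - t) (dist (fst p) (snd p)) *
                       ennreal (enn2real (RN_deriv \<mu> \<nu>0 (fst p)) powr (- 1 / N))
                   + tau \<kappa> N t (dist (fst p) (snd p)) *
                       ennreal (enn2real (RN_deriv \<mu> \<nu>1 (snd p)) powr (- 1 / N)) \<partial>q)
             \<le> (\<integral>\<^sup>+x. ennreal (\<rho> x powr (1 - 1 / N)) \<partial>\<mu>)"
    using H[THEN bspec, OF tin, THEN spec, THEN mp, OF order_refl]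
    by (elim exE conjE) (rule that; assumption)
  note \<rho> = \<rho>'[THEN spec] and dec = dec'[THEN bspec]
  have cpl: "coupling \<nu>0 \<nu>1 q" and cost: "transport_cost q = W2sq \<nu>0 \<nu>1"
    using q by (auto simp: optimal_coupling_def)
  interpret q: prob_space q by (rule coupling_space[OF cpl])
  note q_meas[measurable] = coupling_space(6,7)[OF cpl]
  have [measurable]: "A \<in> sets \<mu>" "cball x \<delta> \<in> sets \<mu>" using A \<mu> by auto
  have AE0: "AE y in \<nu>0. dist x y \<le> \<delta>"
    unfolding \<nu>0_def by (rule eventually_mono[OF AE_uniform_measure_mem]) auto
  have AE1: "AE y in \<nu>1. dist x y \<le> \<epsilon>"
    unfolding \<nu>1_def by (rule eventually_mono[OF AE_uniform_measure_mem]) (use A in auto)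
  have qAE0: "AE p in q. dist x (fst p) \<le> \<delta>"
    using AE0 unfolding coupling_space(4)[OF cpl, symmetric] by (rule AE_distrD[OF q_meas(1)])
  have qAE1: "AE p in q. dist x (snd p) \<le> \<epsilon>"
    using AE1 unfolding coupling_space(5)[OF cpl, symmetric] by (rule AE_distrD[OF q_meas(2)])
  have qdist: "AE p in q. dist (fst p) (snd p) \<le> \<epsilon> + \<delta>"
    using qAE0 qAE1
  proof eventually_elim
    case (elim p)
    then show ?case using dist_triangle3[of "fst p" "snd p" x] by linarith
  qed
  \<comment> \<open>The cost is finite because \<open>q\<close> joins only points at distance at
    most \<epsilon> + \<delta>.\<close>
  obtain w where w: "W2sq \<nu>0 \<nu>1 = ennreal w" "0 \<le> w"
  proof -
    have "transport_cost q \<le> (\<integral>\<^sup>+p. ennreal ((\<epsilon> + \<delta>)\<^sup>2) \<partial>q)"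
      unfolding transport_cost_def using qdist
      by (intro nn_integral_mono_AE, eventually_elim) (auto intro!: ennreal_leI power_mono)
    also have "\<dots> < \<top>" by (simp add: q.emeasure_space_1)
    finally show ?thesis using that unfolding cost by (cases "W2sq \<nu>0 \<nu>1") auto
  qed
  have geo: "W2sq (G u) (G v) = ennreal ((u - v)^2) * W2sq \<nu>0 \<nu>1" if "u \<in> {0..1}" "v \<in> {0..1}" for u v
    using G that by (auto simp: W2_geodesic_def)
  have G01: "G 0 = \<nu>0" "G 1 = \<nu>1" and GP: "P2 (G t)" using G t by (auto simp: W2_geodesic_def)
  have "emeasure (G t) (UNIV - cball x r) = 0"
    unfolding r_def
  proof (rule intermediate_measure_concentrated[OF w])
    show "W2sq \<nu>0 (G t) = ennreal (t\<^sup>2 * w)" using geo[of 0 t] t w by (simp add: G01 ennreal_mult)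
    show "W2sq (G t) \<nu>1 = ennreal ((1 - t)\<^sup>2 * w)"
      using geo[of t 1] t w by (simp add: G01 ennreal_mult power2_commute)
  qed (use AE0 AE1 t s \<epsilon> \<delta> in auto)
  \<comment> \<open>The absolutely continuous part is dominated by \<open>G t\<close>, so its
    density vanishes almost everywhere off the ball.\<close>
  then have "emeasure (density \<mu> (\<lambda>x. ennreal (\<rho> x))) (UNIV - cball x r) = 0"
    using dec[of "UNIV - cball x r"] by simp
  then have \<rho>0: "AE y in \<mu>. y \<notin> cball x r \<longrightarrow> \<rho> y = 0"
    by (subst (asm) emeasure_density) (use \<mu> \<rho> in \<open>auto simp: nn_integral_0_iff_AE indicator_def
         order.antisym elim!: eventually_mono split: if_splits\<close>)
  have \<rho>1: "(\<integral>\<^sup>+y. ennreal (\<rho> y) \<partial>\<mu>) \<le> 1"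
  proof -
    have "emeasure (G t) UNIV = 1"
      using GP prob_space.emeasure_space_1[of "G t"] sets_eq_imp_space_eq[of "G t" borel] by (simp add: P2_def)
    then have "emeasure (density \<mu> (\<lambda>x. ennreal (\<rho> x))) UNIV \<le> 1"
      using dec[of UNIV] by (metis le_iff_add sets.top space_borel)
    then show ?thesis by (subst (asm) emeasure_density) (use \<mu> in auto)
  qed
  have upper: "(\<integral>\<^sup>+y. ennreal (\<rho> y powr (1 - 1 / N)) \<partial>\<mu>) \<le> ennreal (b powr (1 / N))"
    by (rule nn_integral_powr_le[where B="cball x r"]) (use \<mu> b \<rho> \<rho>0 \<rho>1 n in \<open>auto simp: r_def N_def\<close>)
  define T where "T = t * (1 - t\<^sup>2)"
  define M where "M = m powr (1 / N)"
  have T: "0 \<le> T" using t by (auto simp: T_def power_le_one)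
  have M: "0 \<le> M" by (simp add: M_def)
  have c: "0 \<le> c" using \<kappa> by (simp add: c_def)
  have RN: "AE p in q. ennreal (enn2real (RN_deriv \<mu> \<nu>1 (snd p)) powr (- 1 / N)) = ennreal M"
  proof -
    have "AE y in \<nu>1. RN_deriv \<mu> \<nu>1 y = ennreal (1 / m)"
      unfolding \<nu>1_def by (rule RN_deriv_uniform_measure) (use m in auto)
    then have "AE p in q. RN_deriv \<mu> \<nu>1 (snd p) = ennreal (1 / m)"
      by (intro AE_distrD[OF q_meas(2)]) (simp only: coupling_space(5)[OF cpl])
    then show ?thesis
      by eventually_elim (use m in \<open>simp add: M_def powr_divide powr_minus divide_simps\<close>)
  qed
  have int1: "(\<integral>\<^sup>+p. ennreal ((dist x (snd p))\<^sup>2) \<partial>q) = ennreal (I / m)"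
  proof -
    have "(\<integral>\<^sup>+p. ennreal ((dist x (snd p))\<^sup>2) \<partial>q) = (\<integral>\<^sup>+y. ennreal ((dist x y)\<^sup>2) \<partial>\<nu>1)"
      unfolding coupling_space(5)[OF cpl, symmetric] by (subst nn_integral_distr[OF q_meas(2)]) auto
    also have "\<dots> = ennreal (I / m)"
      unfolding \<nu>1_def by (rule nn_integral_uniform_measure_real[OF _ _ m I])
        (auto simp: measurable_cong_sets[OF \<mu> refl])
    finally show ?thesis .
  qed
  have [measurable]: "(\<lambda>p. dist (fst p) (snd p)) \<in> borel_measurable q" by measurable
  have expand: "ennreal (T * M * (1 + c * y)) = ennreal (T * M) * (1 + ennreal c * ennreal y)" if "0 \<le> y" for y
    using T M c that by (simp add: ennreal_mult)
  \<comment> \<open>\<open>?L\<close> measures from the centre x, where the mean square over A is I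
    / m; \<open>?C\<close> measures from the actual starting point, as \<open>tau\<close> does;
    \<open>?k\<close> pays for the exchange through \<open>square_le_perturbed\<close>.\<close>
  let ?L = "\<lambda>p. ennreal (T * M) * (1 + ennreal c * ennreal ((dist x (snd p))\<^sup>2))"
  let ?C = "\<lambda>p. ennreal (T * M * (1 + c * (dist (fst p) (snd p))\<^sup>2))"
  let ?k = "T * M * (c * (2 * \<delta> * \<epsilon>))"
  have "ennreal (T * M * (1 + c * (I / m))) = ennreal (T * M) * (1 + ennreal c * ennreal (I / m))"
    using I(2) m(2) by (intro expand) simp
  also have "\<dots> = (\<integral>\<^sup>+p. ?L p \<partial>q)"
    by (simp add: nn_integral_cmult nn_integral_add q.emeasure_space_1 int1)
  also have "\<dots> \<le> (\<integral>\<^sup>+p. ?C p + ennreal ?k \<partial>q)"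
    using qAE0 qAE1
  proof (intro nn_integral_mono_AE, eventually_elim)
    fix p :: "'a \<times> 'a" assume h: "dist x (fst p) \<le> \<delta>" "dist x (snd p) \<le> \<epsilon>"
    have "dist x (snd p) \<le> dist (fst p) (snd p) + \<delta>"
      using h dist_triangle[of x "snd p" "fst p"] by simp
    then have "(dist x (snd p))\<^sup>2 \<le> (dist (fst p) (snd p))\<^sup>2 + 2 * \<delta> * \<epsilon>"
      using h \<delta> by (intro square_le_perturbed) auto
    then have "T * M * (1 + c * (dist x (snd p))\<^sup>2) \<le> T * M * (1 + c * ((dist (fst p) (snd p))\<^sup>2 + 2 * \<delta> * \<epsilon>))"
      using T M c by (intro mult_left_mono add_left_mono) auto
    also have "\<dots> = T * M * (1 + c * (dist (fst p) (snd p))\<^sup>2) + ?k" by (simp add: algebra_simps)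
    finally have "ennreal (T * M * (1 + c * (dist x (snd p))\<^sup>2)) \<le> ennreal (T * M * (1 + c * (dist (fst p) (snd p))\<^sup>2) + ?k)"
      by (rule ennreal_leI)
    also have "\<dots> = ?C p + ennreal ?k" using T M c \<delta> \<epsilon> by (intro ennreal_plus) auto
    finally show "?L p \<le> ?C p + ennreal ?k" by (simp only: expand zero_le_power2)
  qed
  also have "\<dots> = (\<integral>\<^sup>+p. ?C p \<partial>q) + ennreal ?k"
    by (simp add: nn_integral_add q.emeasure_space_1)
  also have "(\<integral>\<^sup>+p. ?C p \<partial>q) \<le> (\<integral>\<^sup>+p. tau \<kappa> N (1 - t) (dist (fst p) (snd p)) *
                       ennreal (enn2real (RN_deriv \<mu> \<nu>0 (fst p)) powr (- 1 / N))
                   + tau \<kappa> N t (dist (fst p) (snd p)) *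
                       ennreal (enn2real (RN_deriv \<mu> \<nu>1 (snd p)) powr (- 1 / N)) \<partial>q)"
    using qdist RN
  proof (intro nn_integral_mono_AE, eventually_elim)
    fix p :: "'a \<times> 'a" assume h: "dist (fst p) (snd p) \<le> \<epsilon> + \<delta>"
       "ennreal (enn2real (RN_deriv \<mu> \<nu>1 (snd p)) powr (- 1 / N)) = ennreal M"
    have "\<kappa> * (dist (fst p) (snd p))\<^sup>2 \<le> \<kappa> * (\<epsilon> + \<delta>)\<^sup>2"
      using h \<kappa> by (intro mult_left_mono power_mono) auto
    then have "ennreal (T * (1 + c * (dist (fst p) (snd p))\<^sup>2)) \<le> tau \<kappa> N t (dist (fst p) (snd p))"
      unfolding T_def c_def N_def[symmetric] using \<epsilon> \<kappa> t n by (intro tau_ge) (auto simp: N_def)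
    then have "ennreal (T * (1 + c * (dist (fst p) (snd p))\<^sup>2)) * ennreal M \<le> tau \<kappa> N t (dist (fst p) (snd p)) * ennreal M"
      by (rule mult_right_mono) simp
    also have "ennreal (T * (1 + c * (dist (fst p) (snd p))\<^sup>2)) * ennreal M = ?C p"
      using T M c by (subst ennreal_mult[symmetric]) (auto simp: algebra_simps)
    finally have "?C p \<le> tau \<kappa> N t (dist (fst p) (snd p)) * ennreal (enn2real (RN_deriv \<mu> \<nu>1 (snd p)) powr (- 1 / N))"
      unfolding h(2) .
    then show "?C p \<le> tau \<kappa> N (1 - t) (dist (fst p) (snd p)) *
                       ennreal (enn2real (RN_deriv \<mu> \<nu>0 (fst p)) powr (- 1 / N))
                   + tau \<kappa> N t (dist (fst p) (snd p)) *
                       ennreal (enn2real (RN_deriv \<mu> \<nu>1 (snd p)) powr (- 1 / N))"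
      by (rule add_increasing[OF zero_le])
  qed
  also note ineq
  also note upper
  also have "ennreal (b powr (1 / N)) + ennreal ?k = ennreal (b powr (1 / N) + ?k)"
    using T M c \<delta> \<epsilon> by (intro ennreal_plus[symmetric]) auto
  finally have "ennreal (T * M * (1 + c * (I / m))) \<le> ennreal (b powr (1 / N) + ?k)"
    by (blast intro: add_right_mono)
  then have "T * M * (1 + c * (I / m)) \<le> b powr (1 / N) + ?k"
    using T M c \<delta> \<epsilon> by (subst (asm) ennreal_le_iff) auto
  then show ?thesis by (simp add: T_def M_def N_def)
qed

subsection \<open>Volume bounds for small balls\<close>

lemma mm_space_cball:
  fixes \<mu> :: "('a::polish_space) measure"
  assumes "mm_space \<mu>"
  obtains r0 where "0 < r0" "\<And>r. r < r0 \<Longrightarrow> emeasure \<mu> (cball x r) = ennreal (measure \<mu> (cball x r))"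
    "\<And>r. 0 < r \<Longrightarrow> 0 < emeasure \<mu> (cball x r)" "\<And>r. 0 < r \<Longrightarrow> r < r0 \<Longrightarrow> 0 < measure \<mu> (cball x r)"
proof -
  have sets: "sets \<mu> = sets borel" using assms by (simp add: mm_space_def)
  obtain r0 where r0: "0 < r0" "emeasure \<mu> (ball x r0) < \<infinity>" using assms unfolding mm_space_def by blast
  have fin: "emeasure \<mu> (cball x r) = ennreal (measure \<mu> (cball x r))" if "r < r0" for r
  proof -
    have "emeasure \<mu> (cball x r) \<le> emeasure \<mu> (ball x r0)"
      using that sets by (intro emeasure_mono) auto
    with r0 have "emeasure \<mu> (cball x r) < \<infinity>" by simp
    then show ?thesis by (intro emeasure_eq_ennreal_measure) simp
  qed
  have pos: "0 < emeasure \<mu> (cball x r)" if "0 < r" for r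
  proof -
    have "emeasure \<mu> (ball x r) \<le> emeasure \<mu> (cball x r)" using sets by (intro emeasure_mono) auto
    moreover have "0 < emeasure \<mu> (ball x r)" using assms that by (simp add: mm_space_def)
    ultimately show ?thesis by simp
  qed
  have "0 < measure \<mu> (cball x r)" if "0 < r" "r < r0" for r
    using fin[OF that(2)] pos[OF that(1)] by simp
  with fin pos r0 that show ?thesis by blast
qed

text \<open>\<open>CD_volume_step\<close> is divided by t and t tends to 0. The n-dimensional
  condition is evaluated at the shrinking radius \<open>g t\<close> while \<epsilon> stays fixed, so
  the admissible range of \<epsilon> does not depend on x.\<close>

lemma CD_volume_bound:
  fixes \<mu> :: "('a::polish_space) measure" and n :: nat and \<kappa> :: real
  assumes n: "2 \<le> n" and \<kappa>: "0 \<le> \<kappa>" and mm: "mm_space \<mu>" and dim: "n_dimensional n \<mu>" and CD: "CD \<kappa> (real n) \<mu>"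
    and A: "A \<in> sets borel" "A \<subseteq> cball x \<epsilon>" and m: "emeasure \<mu> A = ennreal m" "0 < m"
    and I: "(\<integral>\<^sup>+y. ennreal ((dist x y)\<^sup>2) * indicator A y \<partial>\<mu>) = ennreal I" "0 \<le> I"
    and \<epsilon>: "0 < \<epsilon>" "\<kappa> * \<epsilon>\<^sup>2 < 1"
  defines "c \<equiv> \<kappa> / (6 * real n)"
  shows "m powr (1 / real n) * (1 + c * (I / m)) \<le> unit_ball_vol (real n) powr (1 / real n) * \<epsilon>"
proof -
  have sets: "sets \<mu> = sets borel" using mm by (simp add: mm_space_def)
  obtain r0 where r0: "0 < r0" and fin: "\<And>r. r < r0 \<Longrightarrow> emeasure \<mu> (cball x r) = ennreal (measure \<mu> (cball x r))"
    and pos: "\<And>r. 0 < r \<Longrightarrow> 0 < emeasure \<mu> (cball x r)" "\<And>r. 0 < r \<Longrightarrow> r < r0 \<Longrightarrow> 0 < measure \<mu> (cball x r)"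
    using mm_space_cball[OF mm] by metis
  define \<omega> where "\<omega> = unit_ball_vol (real n)"
  have \<omega>: "0 < \<omega>" by (simp add: \<omega>_def)
  \<comment> \<open>The radius from the concentration estimate with \<delta> = s = t^2. Both
    corrections are o(t), hence g t / t tends to \<epsilon>.\<close>
  define g where "g t = t * (\<epsilon> + t\<^sup>2) + t\<^sup>2 + t\<^sup>2" for t :: real
  define b where "b t = measure \<mu> (cball x (g t))" for t
  define M where "M = m powr (1 / real n)"
  have gt: "(g \<longlongrightarrow> 0) (at_right 0)" unfolding g_def by (auto intro!: tendsto_eq_intros)
  have gpos: "0 < g t" if "0 < t" for t using that \<epsilon> by (auto simp: g_def intro!: add_pos_pos mult_pos_pos)
  have glim: "filterlim g (at_right 0) (at_right 0)"
    using gt by (rule tendsto_imp_filterlim_at_right) (auto intro!: eventually_at_rightI[of 0 1] gpos)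
  have ev_pos: "\<forall>\<^sub>F t in at_right 0. (0::real) < t" by (simp add: eventually_at_right_less)
  have ev1: "\<forall>\<^sub>F t in at_right 0. t < (1::real)" by (rule eventually_at_rightI[of 0 1]) auto
  have "((\<lambda>t. \<kappa> * (\<epsilon> + t\<^sup>2)\<^sup>2) \<longlongrightarrow> \<kappa> * \<epsilon>\<^sup>2) (at_right 0)" by (auto intro!: tendsto_eq_intros)
  then have ev2: "\<forall>\<^sub>F t in at_right 0. \<kappa> * (\<epsilon> + t\<^sup>2)\<^sup>2 < 1" using \<epsilon>(2) by (rule order_tendstoD)
  have ev3: "\<forall>\<^sub>F t in at_right 0. g t < r0" using gt r0 by (rule order_tendstoD)
  have step: "\<forall>\<^sub>F t in at_right 0. (1 - t\<^sup>2) * M * (1 + c * (I / m)) \<le> b t powr (1 / real n) / t + (1 - t\<^sup>2) * M * (c * (2 * t\<^sup>2 * \<epsilon>))"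
    using ev_pos ev1 ev2 ev3
  proof eventually_elim
    case (elim t)
    have "0 < t * (\<epsilon> + t\<^sup>2) + t\<^sup>2" using elim \<epsilon> by (auto intro!: add_pos_pos mult_pos_pos)
    then have t2: "t\<^sup>2 < r0" using elim(4) by (simp add: g_def)
    have "t * (1 - t\<^sup>2) * M * (1 + c * (I / m)) \<le> b t powr (1 / real n) + t * (1 - t\<^sup>2) * M * (c * (2 * t\<^sup>2 * \<epsilon>))"
      unfolding M_def c_def
    proof (rule CD_volume_step[OF n \<kappa> sets CD A m I])
      show "emeasure \<mu> (cball x (t\<^sup>2)) \<noteq> 0" using pos(1)[of "t\<^sup>2"] elim by simp
      show "emeasure \<mu> (cball x (t\<^sup>2)) \<noteq> \<infinity>" using fin[OF t2] by simp
      show "emeasure \<mu> (cball x (t * (\<epsilon> + t\<^sup>2) + t\<^sup>2 + t\<^sup>2)) = ennreal (b t)"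
        using fin[OF elim(4)] by (simp add: b_def g_def)
      show "0 < b t" unfolding b_def using pos(2) gpos elim by blast
    qed (use elim \<epsilon> in auto)
    then have "(t * (1 - t\<^sup>2) * M * (1 + c * (I / m))) / t \<le> (b t powr (1 / real n) + t * (1 - t\<^sup>2) * M * (c * (2 * t\<^sup>2 * \<epsilon>))) / t"
      using elim by (intro divide_right_mono) auto
    then show ?case using elim(1) by (simp add: add_divide_distrib mult.assoc)
  qed
  have lim1: "((\<lambda>t. (1 - t\<^sup>2) * M * (1 + c * (I / m))) \<longlongrightarrow> M * (1 + c * (I / m))) (at_right 0)"
    by (auto intro!: tendsto_eq_intros)
  have "((\<lambda>r. measure \<mu> (cball x r) / vol_E n r) \<longlongrightarrow> 1) (at_right 0)"
    using dim by (simp add: n_dimensional_def)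
  then have "((\<lambda>t. b t / vol_E n (g t)) \<longlongrightarrow> 1) (at_right 0)"
    unfolding b_def by (rule filterlim_compose[OF _ glim])
  then have "((\<lambda>t. (b t / vol_E n (g t)) powr (1 / real n)) \<longlongrightarrow> 1 powr (1 / real n)) (at_right 0)"
    by (intro tendsto_powr tendsto_const) auto
  moreover have "((\<lambda>t. \<epsilon> + t\<^sup>2 + t + t) \<longlongrightarrow> \<epsilon>) (at_right 0)" by (auto intro!: tendsto_eq_intros)
  ultimately have "((\<lambda>t. (b t / vol_E n (g t)) powr (1 / real n) * \<omega> powr (1 / real n) * (\<epsilon> + t\<^sup>2 + t + t))
      \<longlongrightarrow> 1 powr (1 / real n) * \<omega> powr (1 / real n) * \<epsilon>) (at_right 0)"
    by (intro tendsto_mult tendsto_const)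
  then have "((\<lambda>t. (b t / vol_E n (g t)) powr (1 / real n) * \<omega> powr (1 / real n) * (\<epsilon> + t\<^sup>2 + t + t)) \<longlongrightarrow> \<omega> powr (1 / real n) * \<epsilon>) (at_right 0)"
    by simp
  \<comment> \<open>The n-th root of \<open>vol_E n (g t)\<close> is \<omega>^(1/n) g t, and
    division by t leaves \<omega>^(1/n) times \<epsilon> + t^2 + 2t.\<close>
  moreover have "\<forall>\<^sub>F t in at_right 0. (b t / vol_E n (g t)) powr (1 / real n) * \<omega> powr (1 / real n) * (\<epsilon> + t\<^sup>2 + t + t) = b t powr (1 / real n) / t"
    using ev_pos
  proof eventually_elim
    case (elim t)
    have b: "0 \<le> b t" by (simp add: b_def)
    have g: "0 < g t" using gpos elim by simp
    have vE: "vol_E n (g t) = \<omega> * g t ^ n" by (simp add: vol_E_def \<omega>_def)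
    have "b t powr (1 / real n) = ((b t / vol_E n (g t)) * (\<omega> * g t ^ n)) powr (1 / real n)"
      using \<omega> g by (simp add: vE)
    also have "\<dots> = (b t / vol_E n (g t)) powr (1 / real n) * (\<omega> powr (1 / real n) * (g t ^ n) powr (1 / real n))"
    proof -
      have *: "(u * (v * w)) powr p = u powr p * (v powr p * w powr p)" if "0 \<le> u" "0 \<le> v" "0 \<le> w" for u v w p :: real
        using that by (simp add: powr_mult)
      show ?thesis by (rule *) (use \<omega> g b in \<open>auto simp: vE\<close>)
    qed
    also have "(g t ^ n) powr (1 / real n) = g t"
      using g n by (simp add: powr_realpow[symmetric] powr_powr)
    finally have "b t powr (1 / real n) / t = (b t / vol_E n (g t)) powr (1 / real n) * \<omega> powr (1 / real n) * (g t / t)"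
      by simp
    moreover have "g t / t = \<epsilon> + t\<^sup>2 + t + t" using elim by (simp add: g_def field_simps power2_eq_square)
    ultimately show ?case by simp
  qed
  ultimately have "((\<lambda>t. b t powr (1 / real n) / t) \<longlongrightarrow> \<omega> powr (1 / real n) * \<epsilon>) (at_right 0)"
    by (rule Lim_transform_eventually)
  moreover have "((\<lambda>t. (1 - t\<^sup>2) * M * (c * (2 * t\<^sup>2 * \<epsilon>))) \<longlongrightarrow> 0) (at_right 0)"
    by (auto intro!: tendsto_eq_intros)
  ultimately have lim2: "((\<lambda>t. b t powr (1 / real n) / t + (1 - t\<^sup>2) * M * (c * (2 * t\<^sup>2 * \<epsilon>))) \<longlongrightarrow> \<omega> powr (1 / real n) * \<epsilon> + 0) (at_right 0)"
    by (rule tendsto_add)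
  have "M * (1 + c * (I / m)) \<le> \<omega> powr (1 / real n) * \<epsilon>"
    using tendsto_le[OF _ lim2 lim1 step] by simp
  then show ?thesis by (simp add: M_def \<omega>_def)
qed

lemma second_moment_finite:
  fixes \<mu> :: "('a::metric_space) measure"
  assumes "sets \<mu> = sets borel" "A \<in> sets borel" "A \<subseteq> cball x \<epsilon>" "emeasure \<mu> A = ennreal m"
  obtains I where "(\<integral>\<^sup>+y. ennreal ((dist x y)\<^sup>2) * indicator A y \<partial>\<mu>) = ennreal I" "0 \<le> I"
proof -
  have "(\<integral>\<^sup>+y. ennreal ((dist x y)\<^sup>2) * indicator A y \<partial>\<mu>) \<le> (\<integral>\<^sup>+y. ennreal (\<epsilon>\<^sup>2) * indicator A y \<partial>\<mu>)"
    using assms(3) by (intro nn_integral_mono) (auto simp: indicator_def intro!: ennreal_leI power_mono)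
  also have "\<dots> = ennreal (\<epsilon>\<^sup>2) * ennreal m"
    using assms by (subst nn_integral_cmult_indicator) auto
  also have "\<dots> < \<top>" by (simp add: ennreal_mult_less_top)
  finally show ?thesis
    using that by (cases "\<integral>\<^sup>+y. ennreal ((dist x y)\<^sup>2) * indicator A y \<partial>\<mu>") auto
qed

text \<open>Local finiteness does not make the \<epsilon>-ball finite from the start. The bound is
  proved for its intersections with an exhaustion by sets of finite measure, where the moment term
  is estimated below by 0, and then passes to the supremum.\<close>

lemma CD_emeasure_cball_le:
  fixes \<mu> :: "('a::polish_space) measure" and n :: nat and \<kappa> :: real
  assumes n: "2 \<le> n" and \<kappa>: "0 \<le> \<kappa>" and mm: "mm_space \<mu>" and dim: "n_dimensional n \<mu>" and CD: "CD \<kappa> (real n) \<mu>"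
    and \<epsilon>: "0 < \<epsilon>" "\<kappa> * \<epsilon>\<^sup>2 < 1"
  shows "emeasure \<mu> (cball x \<epsilon>) \<le> ennreal (vol_E n \<epsilon>)"
proof -
  have sets: "sets \<mu> = sets borel" using mm by (simp add: mm_space_def)
  interpret sigma_finite_measure \<mu> by (rule mm_space_sigma_finite[OF mm])
  obtain F :: "nat \<Rightarrow> 'a set" where F: "range F \<subseteq> sets \<mu>" "(\<Union>i. F i) = space \<mu>" "\<And>i. emeasure \<mu> (F i) \<noteq> \<infinity>" "incseq F"
    using sigma_finite_incseq by metis
  have "emeasure \<mu> (cball x \<epsilon> \<inter> F i) \<le> ennreal (vol_E n \<epsilon>)" for i
  proof -
    let ?A = "cball x \<epsilon> \<inter> F i"
    have A: "?A \<in> sets borel" "?A \<subseteq> cball x \<epsilon>" using F(1) sets by auto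
    have "emeasure \<mu> ?A \<le> emeasure \<mu> (F i)" using F(1) by (intro emeasure_mono) auto
    with F(3)[of i] obtain m where m: "emeasure \<mu> ?A = ennreal m" "0 \<le> m"
      by (cases "emeasure \<mu> ?A") (auto simp: top_unique)
    have "m \<le> vol_E n \<epsilon>"
    proof (cases "m = 0")
      case True
      then show ?thesis using \<epsilon> by (simp add: vol_E_def)
    next
      case False
      then have m0: "0 < m" using m by simp
      obtain I where I: "(\<integral>\<^sup>+y. ennreal ((dist x y)\<^sup>2) * indicator ?A y \<partial>\<mu>) = ennreal I" "0 \<le> I"
        using second_moment_finite[OF sets A m(1)] by metis
      have "m powr (1 / real n) * 1 \<le> m powr (1 / real n) * (1 + \<kappa> / (6 * real n) * (I / m))"
        using \<kappa> I(2) m0 by (intro mult_left_mono) auto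
      also have "\<dots> \<le> unit_ball_vol (real n) powr (1 / real n) * \<epsilon>"
        by (rule CD_volume_bound[OF n \<kappa> mm dim CD A m(1) m0 I \<epsilon>])
      finally have "(m powr (1 / real n)) ^ n \<le> (unit_ball_vol (real n) powr (1 / real n) * \<epsilon>) ^ n"
        by (intro power_mono) auto
      moreover have "(u powr (1 / real n)) ^ n = u" if "0 < u" for u :: real
        using that n by (simp add: powr_power)
      ultimately show ?thesis
        using m0 by (simp add: vol_E_def power_mult_distrib)
    qed
    then show ?thesis using m by (simp add: ennreal_leI)
  qed
  moreover have "emeasure \<mu> (cball x \<epsilon>) = (SUP i. emeasure \<mu> (cball x \<epsilon> \<inter> F i))"
  proof -
    have "(SUP i. emeasure \<mu> (cball x \<epsilon> \<inter> F i)) = emeasure \<mu> (\<Union>i. cball x \<epsilon> \<inter> F i)"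
    proof (rule SUP_emeasure_incseq)
      show "incseq (\<lambda>i. cball x \<epsilon> \<inter> F i)" using F(4) unfolding incseq_def by blast
    qed (use F(1) sets in auto)
    also have "(\<Union>i. cball x \<epsilon> \<inter> F i) = cball x \<epsilon>"
      using F(2) sets_eq_imp_space_eq[OF sets] by auto
    finally show ?thesis by simp
  qed
  ultimately show ?thesis by (simp add: SUP_le_iff)
qed

text \<open>Tonelli on the region f x \<le> s \<le> \<epsilon>. It serves twice: with G s = s^2 and
  the distance to x, and with a cap area and the Euclidean norm on R^(n-2).\<close>

lemma nn_integral_layer_cake:
  fixes f :: "'b \<Rightarrow> real" and G g :: "real \<Rightarrow> real"
  assumes "sigma_finite_measure M" and f[measurable]: "f \<in> borel_measurable M" and f0: "\<And>x. x \<in> space M \<Longrightarrow> 0 \<le> f x"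
    and g[measurable]: "g \<in> borel_measurable borel" and g0: "\<And>s. 0 \<le> s \<Longrightarrow> s \<le> \<epsilon> \<Longrightarrow> 0 \<le> g s"
    and G: "\<And>s. 0 \<le> s \<Longrightarrow> s \<le> \<epsilon> \<Longrightarrow> (G has_real_derivative g s) (at s)"
  shows "(\<integral>\<^sup>+x. ennreal (G \<epsilon> - G (f x)) * indicator {x \<in> space M. f x \<le> \<epsilon>} x \<partial>M)
    = (\<integral>\<^sup>+s. ennreal (g s) * emeasure M {x \<in> space M. f x \<le> s} * indicator {0..\<epsilon>} s \<partial>lborel)"
proof -
  interpret sigma_finite_measure M by fact
  interpret pair_sigma_finite lborel M ..
  have "(\<integral>\<^sup>+x. ennreal (G \<epsilon> - G (f x)) * indicator {x \<in> space M. f x \<le> \<epsilon>} x \<partial>M)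
    = (\<integral>\<^sup>+x. \<integral>\<^sup>+s. ennreal (g s) * indicator {0..\<epsilon>} s * (if f x \<le> s then 1 else 0) \<partial>lborel \<partial>M)"
  proof (intro nn_integral_cong)
    fix x assume x: "x \<in> space M"
    show "ennreal (G \<epsilon> - G (f x)) * indicator {x \<in> space M. f x \<le> \<epsilon>} x
      = (\<integral>\<^sup>+s. ennreal (g s) * indicator {0..\<epsilon>} s * (if f x \<le> s then 1 else 0) \<partial>lborel)"
    proof (cases "f x \<le> \<epsilon>")
      case True
      have "(\<integral>\<^sup>+s. ennreal (g s) * indicator {0..\<epsilon>} s * (if f x \<le> s then 1 else 0) \<partial>lborel) = (\<integral>\<^sup>+s. ennreal (g s) * indicator {f x..\<epsilon>} s \<partial>lborel)"
        using f0[OF x] by (intro nn_integral_cong) (auto simp: indicator_def)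
      also have "\<dots> = ennreal (G \<epsilon> - G (f x))"
        using f0[OF x] True g0 G by (intro nn_integral_FTC_Icc) auto
      finally show ?thesis using x True by simp
    next
      case False
      then have "(\<integral>\<^sup>+s. ennreal (g s) * indicator {0..\<epsilon>} s * (if f x \<le> s then 1 else 0) \<partial>lborel) = 0"
        by (intro nn_integral_zero') (auto simp: indicator_def)
      then show ?thesis using x False by simp
    qed
  qed
  also have "\<dots> = (\<integral>\<^sup>+s. \<integral>\<^sup>+x. ennreal (g s) * indicator {0..\<epsilon>} s * (if f x \<le> s then 1 else 0) \<partial>M \<partial>lborel)"
    by (rule Fubini') measurable
  also have "\<dots> = (\<integral>\<^sup>+s. ennreal (g s) * emeasure M {x \<in> space M. f x \<le> s} * indicator {0..\<epsilon>} s \<partial>lborel)"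
  proof (intro nn_integral_cong)
    fix s :: real
    have "(\<integral>\<^sup>+x. ennreal (g s) * indicator {0..\<epsilon>} s * (if f x \<le> s then 1 else 0) \<partial>M)
        = (\<integral>\<^sup>+x. ennreal (g s) * indicator {0..\<epsilon>} s * indicator {x \<in> space M. f x \<le> s} x \<partial>M)"
      by (intro nn_integral_cong) (auto simp: indicator_def)
    also have "\<dots> = ennreal (g s) * indicator {0..\<epsilon>} s * emeasure M {x \<in> space M. f x \<le> s}"
      by (intro nn_integral_cmult_indicator) measurable
    finally show "(\<integral>\<^sup>+x. ennreal (g s) * indicator {0..\<epsilon>} s * (if f x \<le> s then 1 else 0) \<partial>M)
      = ennreal (g s) * emeasure M {x \<in> space M. f x \<le> s} * indicator {0..\<epsilon>} s"
      by (simp add: mult_ac)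
  qed
  finally show ?thesis .
qed

text \<open>Small balls hold little mass, so M has to sit far from x. Integrating 2s \<mu>(B_s(x))
  \<le> 2 \<omega> s^(n+1) over [0, \<epsilon>] bounds the defect \<epsilon>^2 M - I.\<close>

lemma second_moment_ge:
  fixes \<mu> :: "('a::polish_space) measure" and n :: nat
  assumes "sigma_finite_measure \<mu>" and sets: "sets \<mu> = sets borel" and "0 < \<epsilon>"
    and vol: "\<And>s. 0 < s \<Longrightarrow> s \<le> \<epsilon> \<Longrightarrow> emeasure \<mu> (cball x s) \<le> ennreal (vol_E n s)"
    and M: "emeasure \<mu> (cball x \<epsilon>) = ennreal M" "0 \<le> M"
    and I: "(\<integral>\<^sup>+y. ennreal ((dist x y)\<^sup>2) * indicator (cball x \<epsilon>) y \<partial>\<mu>) = ennreal I" "0 \<le> I"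
  shows "\<epsilon>\<^sup>2 * M - 2 * vol_E n \<epsilon> * \<epsilon>\<^sup>2 / (real n + 2) \<le> I"
proof -
  define \<omega> where "\<omega> = unit_ball_vol (real n)"
  have \<omega>: "0 \<le> \<omega>" by (simp add: \<omega>_def)
  have sp: "space \<mu> = UNIV" using sets_eq_imp_space_eq[OF sets] by simp
  have [measurable]: "dist x \<in> borel_measurable \<mu>" by (simp add: measurable_cong_sets[OF sets refl])
  have cb: "{y \<in> space \<mu>. dist x y \<le> s} = cball x s" for s by (auto simp: sp)
  have [measurable]: "cball x \<epsilon> \<in> sets \<mu>" by (simp add: sets)
  have "(\<integral>\<^sup>+y. ennreal (\<epsilon>\<^sup>2 - (dist x y)\<^sup>2) * indicator {y \<in> space \<mu>. dist x y \<le> \<epsilon>} y \<partial>\<mu>)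
      = (\<integral>\<^sup>+s. ennreal (2 * s) * emeasure \<mu> {y \<in> space \<mu>. dist x y \<le> s} * indicator {0..\<epsilon>} s \<partial>lborel)"
    by (rule nn_integral_layer_cake[OF assms(1)]) (auto intro!: derivative_eq_intros)
  also have "\<dots> \<le> (\<integral>\<^sup>+s. ennreal (2 * \<omega> * s ^ (n + 1)) * indicator {0..\<epsilon>} s \<partial>lborel)"
  proof (intro nn_integral_mono)
    fix s :: real
    show "ennreal (2 * s) * emeasure \<mu> {y \<in> space \<mu>. dist x y \<le> s} * indicator {0..\<epsilon>} s \<le> ennreal (2 * \<omega> * s ^ (n + 1)) * indicator {0..\<epsilon>} s"
    proof (cases "0 < s \<and> s \<le> \<epsilon>")
      case True
      have "ennreal (2 * s) * emeasure \<mu> (cball x s) \<le> ennreal (2 * s) * ennreal (vol_E n s)"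
        using vol True by (intro mult_left_mono) auto
      also have "\<dots> = ennreal (2 * s * vol_E n s)"
        using True by (intro ennreal_mult[symmetric]) (auto simp: vol_E_def)
      also have "2 * s * vol_E n s = 2 * \<omega> * s ^ (n + 1)" by (simp add: vol_E_def \<omega>_def)
      finally show ?thesis using True by (simp add: cb)
    next
      \<comment> \<open>At s = 0, where \<open>vol\<close> says nothing, the factor 2s
        vanishes.\<close>
      case False
      then show ?thesis by (auto simp: indicator_def)
    qed
  qed
  also have "\<dots> = ennreal (2 * \<omega> / (real n + 2) * \<epsilon> ^ (n + 2) - 2 * \<omega> / (real n + 2) * 0 ^ (n + 2))"
  proof (rule nn_integral_FTC_Icc)
    fix s :: real
    show "((\<lambda>s. 2 * \<omega> / (real n + 2) * s ^ (n + 2)) has_real_derivative 2 * \<omega> * s ^ (n + 1)) (at s)"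
      by (rule DERIV_cong[OF DERIV_cmult[OF DERIV_pow]]) (simp add: field_simps)
  qed (use \<omega> \<open>0 < \<epsilon>\<close> in auto)
  also have "2 * \<omega> / (real n + 2) * \<epsilon> ^ (n + 2) - 2 * \<omega> / (real n + 2) * 0 ^ (n + 2) = 2 * vol_E n \<epsilon> * \<epsilon>\<^sup>2 / (real n + 2)"
    by (simp add: vol_E_def \<omega>_def power_add power2_eq_square)
  finally have le: "(\<integral>\<^sup>+y. ennreal (\<epsilon>\<^sup>2 - (dist x y)\<^sup>2) * indicator (cball x \<epsilon>) y \<partial>\<mu>) \<le> ennreal (2 * vol_E n \<epsilon> * \<epsilon>\<^sup>2 / (real n + 2))"
    by (simp add: cb)
  have "ennreal (\<epsilon>\<^sup>2 * M) = (\<integral>\<^sup>+y. ennreal (\<epsilon>\<^sup>2) * indicator (cball x \<epsilon>) y \<partial>\<mu>)"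
    using M by (subst nn_integral_cmult_indicator) (auto simp: ennreal_mult)
  also have "\<dots> = (\<integral>\<^sup>+y. ennreal (\<epsilon>\<^sup>2 - (dist x y)\<^sup>2) * indicator (cball x \<epsilon>) y + ennreal ((dist x y)\<^sup>2) * indicator (cball x \<epsilon>) y \<partial>\<mu>)"
    by (intro nn_integral_cong) (auto simp: indicator_def ennreal_plus[symmetric] power_mono simp del: ennreal_plus)
  also have "\<dots> = (\<integral>\<^sup>+y. ennreal (\<epsilon>\<^sup>2 - (dist x y)\<^sup>2) * indicator (cball x \<epsilon>) y \<partial>\<mu>) + ennreal I"
    unfolding I(1)[symmetric] by (rule nn_integral_add) measurable
  also have "\<dots> \<le> ennreal (2 * vol_E n \<epsilon> * \<epsilon>\<^sup>2 / (real n + 2)) + ennreal I"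
    using le by (rule add_right_mono)
  also have "\<dots> = ennreal (2 * vol_E n \<epsilon> * \<epsilon>\<^sup>2 / (real n + 2) + I)"
    using I(2) \<open>0 < \<epsilon>\<close> by (intro ennreal_plus[symmetric]) (auto simp: vol_E_def)
  finally have "\<epsilon>\<^sup>2 * M \<le> 2 * vol_E n \<epsilon> * \<epsilon>\<^sup>2 / (real n + 2) + I"
    using I(2) \<open>0 < \<epsilon>\<close> by (subst (asm) ennreal_le_iff) (auto simp: vol_E_def)
  then show ?thesis by simp
qed

text \<open>Taking the n-th power of \<open>CD_volume_bound\<close> and applying Bernoulli gives M +
  \<kappa>/6 I \<le> V, V being the Euclidean volume, since n times \<kappa>/(6n) is \<kappa>/6.
  Inserting the moment bound leaves an inequality linear in M and adds the term \<kappa>/(3(n + 2))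
  on the side of V.\<close>

lemma CD_measure_cball_le:
  fixes \<mu> :: "('a::polish_space) measure" and n :: nat and \<kappa> :: real
  assumes n: "2 \<le> n" and \<kappa>: "0 \<le> \<kappa>" and mm: "mm_space \<mu>" and dim: "n_dimensional n \<mu>" and CD: "CD \<kappa> (real n) \<mu>"
    and \<epsilon>: "0 < \<epsilon>" "\<kappa> * \<epsilon>\<^sup>2 < 1"
  obtains M where "emeasure \<mu> (cball x \<epsilon>) = ennreal M" "0 < M"
    "M * (1 + \<kappa> / 6 * \<epsilon>\<^sup>2) \<le> vol_E n \<epsilon> * (1 + \<kappa> / 3 * \<epsilon>\<^sup>2 / (real n + 2))"
proof -
  have sets: "sets \<mu> = sets borel" using mm by (simp add: mm_space_def)
  have vol: "emeasure \<mu> (cball x s) \<le> ennreal (vol_E n s)" if "0 < s" "s \<le> \<epsilon>" for s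
  proof (rule CD_emeasure_cball_le[OF n \<kappa> mm dim CD])
    have "\<kappa> * s\<^sup>2 \<le> \<kappa> * \<epsilon>\<^sup>2" using that \<kappa> by (intro mult_left_mono power_mono) auto
    then show "\<kappa> * s\<^sup>2 < 1" using \<epsilon> by linarith
  qed fact
  obtain M where M: "emeasure \<mu> (cball x \<epsilon>) = ennreal M" "0 \<le> M"
    using vol[of \<epsilon>] \<epsilon> by (cases "emeasure \<mu> (cball x \<epsilon>)") (auto simp: top_unique)
  have "0 < emeasure \<mu> (cball x \<epsilon>)" using mm_space_cball[OF mm] \<epsilon>(1) by metis
  then have M0: "0 < M" using M by simp
  have A: "cball x \<epsilon> \<in> sets borel" "cball x \<epsilon> \<subseteq> cball x \<epsilon>" by auto
  obtain I where I: "(\<integral>\<^sup>+y. ennreal ((dist x y)\<^sup>2) * indicator (cball x \<epsilon>) y \<partial>\<mu>) = ennreal I" "0 \<le> I"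
    using second_moment_finite[OF sets A M(1)] by metis
  have Ige: "\<epsilon>\<^sup>2 * M - 2 * vol_E n \<epsilon> * \<epsilon>\<^sup>2 / (real n + 2) \<le> I"
    by (rule second_moment_ge[OF mm_space_sigma_finite[OF mm] sets \<epsilon>(1) vol M I])
  define c where "c = \<kappa> / (6 * real n)"
  have c: "0 \<le> c" using \<kappa> by (simp add: c_def)
  have root: "(u powr (1 / real n)) ^ n = u" if "0 < u" for u :: real
    using that n by (simp add: powr_power)
  have "M powr (1 / real n) * (1 + c * (I / M)) \<le> unit_ball_vol (real n) powr (1 / real n) * \<epsilon>"
    unfolding c_def by (rule CD_volume_bound[OF n \<kappa> mm dim CD A M(1) M0 I \<epsilon>])
  then have "(M powr (1 / real n) * (1 + c * (I / M))) ^ n \<le> (unit_ball_vol (real n) powr (1 / real n) * \<epsilon>) ^ n"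
    using c I(2) M0 by (intro power_mono) auto
  then have *: "M * (1 + c * (I / M)) ^ n \<le> vol_E n \<epsilon>"
    using root M0 by (simp add: power_mult_distrib vol_E_def)
  have "1 + real n * (c * (I / M)) \<le> (1 + c * (I / M)) ^ n"
    using c I(2) M0 by (intro Bernoulli_inequality) (auto intro: order_trans[of _ 0])
  then have "M * (1 + real n * (c * (I / M))) \<le> vol_E n \<epsilon>"
    using * M0 by (meson less_imp_le mult_left_mono order_trans)
  moreover have "M * (1 + real n * (c * (I / M))) = M + \<kappa> / 6 * I"
    using M0 n by (simp add: c_def field_simps)
  moreover have "\<kappa> / 6 * (\<epsilon>\<^sup>2 * M - 2 * vol_E n \<epsilon> * \<epsilon>\<^sup>2 / (real n + 2)) \<le> \<kappa> / 6 * I"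
    using Ige \<kappa> by (intro mult_left_mono) auto
  ultimately have "M + \<kappa> / 6 * (\<epsilon>\<^sup>2 * M - 2 * vol_E n \<epsilon> * \<epsilon>\<^sup>2 / (real n + 2)) \<le> vol_E n \<epsilon>" by linarith
  then have "M * (1 + \<kappa> / 6 * \<epsilon>\<^sup>2) \<le> vol_E n \<epsilon> * (1 + \<kappa> / 3 * \<epsilon>\<^sup>2 / (real n + 2))"
    by (simp add: algebra_simps)
  then show ?thesis using that M M0 by blast
qed

text \<open>E stands for \<epsilon>^2. The net curvature gain is \<kappa>/6 - \<kappa>/(3(n + 2)) =
  n\<kappa>/(6(n + 2)); \<open>small\<close> says that its excess over a outweighs the term of order
  E^2.\<close>

lemma volume_ratio_less:
  fixes M V :: real and n :: nat
  assumes V: "0 < V" and "0 < E" and "0 \<le> \<kappa>"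
    and le: "M * (1 + \<kappa> / 6 * E) \<le> V * (1 + \<kappa> / 3 * E / (real n + 2))"
    and small: "a * (\<kappa> / 6) * E < real n * \<kappa> / (6 * (real n + 2)) - a"
  shows "M < V * (1 - a * E)"
proof -
  have "(1 - a * E) * (1 + \<kappa> / 6 * E) - (1 + \<kappa> / 3 * E / (real n + 2))
      = E * (\<kappa> / 6 - \<kappa> / 3 / (real n + 2) - a - a * (\<kappa> / 6) * E)"
    by (simp add: field_simps)
  also have "\<kappa> / 6 - \<kappa> / 3 / (real n + 2) = real n * \<kappa> / (6 * (real n + 2))"
    by (simp add: field_simps)
  also have "E * (real n * \<kappa> / (6 * (real n + 2)) - a - a * (\<kappa> / 6) * E) > 0"
    using small \<open>0 < E\<close> by (intro mult_pos_pos) auto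
  finally have "1 + \<kappa> / 3 * E / (real n + 2) < (1 - a * E) * (1 + \<kappa> / 6 * E)" by simp
  then have "V * (1 + \<kappa> / 3 * E / (real n + 2)) < V * ((1 - a * E) * (1 + \<kappa> / 6 * E))"
    using V by simp
  with le have "M * (1 + \<kappa> / 6 * E) < V * (1 - a * E) * (1 + \<kappa> / 6 * E)" by (simp add: mult.assoc)
  moreover have "0 < 1 + \<kappa> / 6 * E" using \<open>0 \<le> \<kappa>\<close> \<open>0 < E\<close> by (simp add: add_pos_nonneg)
  ultimately show ?thesis by (simp add: mult_less_cancel_right)
qed

subsection \<open>Balls in the product of a sphere and a Euclidean space\<close>

lemma measurable_vec3:
  "(\<lambda>(h, y). vector [h, fst y, snd y] :: real^3) \<in> measurable (lborel \<Otimes>\<^sub>M lborel) borel"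
  (is "?\<Phi> \<in> _")
proof -
  have "continuous_on UNIV (\<lambda>w. ?\<Phi> w $ i)" for i
    using exhaust_3[of i] by (elim disjE)
      (simp_all add: case_prod_beta continuous_on_fst continuous_on_snd continuous_on_id)
  then have "continuous_on UNIV (\<lambda>w. \<chi> i. ?\<Phi> w $ i)" by (intro continuous_on_vec_lambda)
  then have "continuous_on UNIV ?\<Phi>" by simp
  then have "?\<Phi> \<in> measurable borel borel" by (rule borel_measurable_continuous_onI)
  then show ?thesis by (simp add: lborel_prod)
qed

text \<open>Lebesgue measure is determined by boxes, and a box pulls back to a product of three
  intervals. The splitting into R and R^2 opens slices orthogonal to the axis to Fubini.\<close>

lemma lborel_vec3:
  "lborel = distr (lborel \<Otimes>\<^sub>M lborel) borel (\<lambda>(h, y). vector [h, fst y, snd y] :: real^3)"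
  (is "_ = distr _ _ ?\<Phi>")
proof (rule lborel_eqI)
  fix l u :: "real^3" assume le: "\<And>b. b \<in> Basis \<Longrightarrow> l \<bullet> b \<le> u \<bullet> b"
  then have le': "l $ i \<le> u $ i" for i
    using le[of "axis i 1"] by (simp add: inner_axis axis_in_Basis_iff)
  have "emeasure (distr (lborel \<Otimes>\<^sub>M lborel) borel ?\<Phi>) (box l u) = emeasure (lborel \<Otimes>\<^sub>M lborel) (?\<Phi> -` box l u \<inter> space (lborel \<Otimes>\<^sub>M lborel))"
    by (rule emeasure_distr[OF measurable_vec3]) simp
  also have "?\<Phi> -` box l u \<inter> space (lborel \<Otimes>\<^sub>M lborel) = {l$1<..<u$1} \<times> ({l$2<..<u$2} \<times> {l$3<..<u$3})"
    by (auto simp: mem_box_cart forall_3 space_pair_measure)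
  also have "emeasure (lborel \<Otimes>\<^sub>M lborel) \<dots> = emeasure lborel {l$1<..<u$1} * emeasure lborel ({l$2<..<u$2} \<times> {l$3<..<u$3})"
    by (rule lborel.emeasure_pair_measure_Times) (auto simp: borel_Times)
  also have "emeasure lborel ({l$2<..<u$2} \<times> {l$3<..<u$3}) = emeasure lborel {l$2<..<u$2} * emeasure lborel {l$3<..<u$3}"
    unfolding lborel_prod[symmetric] by (rule lborel.emeasure_pair_measure_Times) auto
  also have "emeasure lborel {l$1<..<u$1} * (emeasure lborel {l$2<..<u$2} * emeasure lborel {l$3<..<u$3})
      = ennreal ((u$1 - l$1) * ((u$2 - l$2) * (u$3 - l$3)))"
    using le' by (simp add: ennreal_mult)
  also have "(u$1 - l$1) * ((u$2 - l$2) * (u$3 - l$3)) = (\<Prod>i\<in>UNIV. (u - l) $ i)"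
    unfolding UNIV_3 by simp
  also have "\<dots> = (\<Prod>b\<in>Basis. (u - l) \<bullet> b)"
  proof -
    have 1: "Basis = range (\<lambda>i. axis i 1 :: real^3)" by (auto simp: Basis_vec_def)
    have 2: "inj (\<lambda>i. axis i 1 :: real^3)" by (auto simp: inj_on_def axis_eq_axis)
    show ?thesis unfolding 1 prod.reindex[OF 2] by (simp add: inner_axis)
  qed
  finally show "emeasure (distr (lborel \<Otimes>\<^sub>M lborel) borel ?\<Phi>) (box l u) = ennreal (\<Prod>b\<in>Basis. (u - l) \<bullet> b)" .
qed simp

lemma norm_vec3: "norm (vector [h, fst y, snd y] :: real^3) = sqrt (h\<^sup>2 + (norm y)\<^sup>2)"
  by (simp add: norm_vec_def L2_set_def sum_3 norm_prod_def add.assoc)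

text \<open>Slices orthogonal to the axis are discs: of the cone up to height \<gamma> C, of the ball above it.\<close>
lemma emeasure_spherical_sector_ge:
  fixes \<gamma> C :: real
  assumes \<gamma>: "0 < \<gamma>" and C: "0 < C" "C \<le> 1"
  shows "ennreal (2 / 3 * pi * \<gamma> ^ 3 * (1 - C)) \<le> emeasure lborel {x :: real^3. norm x < \<gamma> \<and> 0 < x $ 1 \<and> C * norm x \<le> x $ 1}"
    (is "_ \<le> emeasure lborel ?S")
proof -
  let ?\<Phi> = "\<lambda>(h, y). vector [h, fst y, snd y] :: real^3"
  \<comment> \<open>If C = cos \<phi> then k = tan^2 \<phi>: the cone has at height h a disc of
    squared radius k h^2 and meets the sphere at h = \<gamma> C.\<close>
  define k where "k = 1 / C\<^sup>2 - 1"
  have k: "0 \<le> k" using C by (simp add: k_def power_le_one)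
  have S[measurable]: "?S \<in> sets borel" by measurable

  let ?T = "?\<Phi> -` ?S \<inter> space (lborel \<Otimes>\<^sub>M lborel)"
  have "emeasure lborel ?S = emeasure (lborel \<Otimes>\<^sub>M lborel) ?T"
    by (subst lborel_vec3, rule emeasure_distr[OF measurable_vec3]) simp
  also have "\<dots> = (\<integral>\<^sup>+h. emeasure lborel (Pair h -` ?T) \<partial>lborel)"
    by (intro lborel.emeasure_pair_measure_alt measurable_sets[OF measurable_vec3]) simp
  also have "\<dots> \<ge> (\<integral>\<^sup>+h. ennreal (pi * k * h\<^sup>2) * indicator {0..\<gamma> * C} h + ennreal (pi * (\<gamma>\<^sup>2 - h\<^sup>2)) * indicator {\<gamma> * C..\<gamma>} h \<partial>lborel)"
  \<comment> \<open>The three heights at which boundary cases arise form a null set.\<close>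
  proof (intro nn_integral_mono_AE, use AE_lborel_singleton[of 0] AE_lborel_singleton[of "\<gamma> * C"] AE_lborel_singleton[of \<gamma>] in eventually_elim)
    fix h :: real assume h: "h \<noteq> 0" "h \<noteq> \<gamma> * C" "h \<noteq> \<gamma>"
    have meas: "Pair h -` ?T \<in> sets lborel"
      by (intro sets_Pair1[of _ lborel] measurable_sets[OF measurable_vec3]) simp
    have vol: "emeasure lborel (ball 0 r :: (real \<times> real) set) = ennreal (pi * r\<^sup>2)" if "0 \<le> r" for r
      using emeasure_ball[OF that, of "0 :: real \<times> real"] by (simp add: eval_unit_ball_vol power2_eq_square)
    have mem: "y \<in> Pair h -` ?T" if "0 < h" "(norm y)\<^sup>2 \<le> k * h\<^sup>2" "(norm y)\<^sup>2 < \<gamma>\<^sup>2 - h\<^sup>2" for y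
    proof -
      have "sqrt (h\<^sup>2 + (norm y)\<^sup>2) < \<gamma>"
        using that(3) \<gamma> by (intro real_less_lsqrt) auto
      moreover have "C\<^sup>2 * (h\<^sup>2 + (norm y)\<^sup>2) \<le> h\<^sup>2"
      proof -
        have "C\<^sup>2 * (h\<^sup>2 + (norm y)\<^sup>2) \<le> C\<^sup>2 * (h\<^sup>2 + k * h\<^sup>2)"
          using that by (intro mult_left_mono) auto
        also have "\<dots> = h\<^sup>2" using C by (simp add: k_def field_simps)
        finally show ?thesis .
      qed
      then have "sqrt (C\<^sup>2 * (h\<^sup>2 + (norm y)\<^sup>2)) \<le> h" using that(1) by (intro real_le_lsqrt) auto
      then have "C * sqrt (h\<^sup>2 + (norm y)\<^sup>2) \<le> h" using C by (simp add: real_sqrt_mult)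
      ultimately show ?thesis using that(1) by (simp add: norm_vec3 space_pair_measure)
    qed
    \<comment> \<open>By this identity k h^2 and \<gamma>^2 - h^2 change order exactly at h =
      \<gamma> C, so each case below takes the disc of smaller radius.\<close>
    have C2: "(k + 1) * C\<^sup>2 = 1" using C by (simp add: k_def)
    consider "0 < h" "h < \<gamma> * C" | "\<gamma> * C < h" "h < \<gamma>" | "h < 0 \<or> \<gamma> < h"
      using h by linarith
    then show "ennreal (pi * k * h\<^sup>2) * indicator {0..\<gamma> * C} h + ennreal (pi * (\<gamma>\<^sup>2 - h\<^sup>2)) * indicator {\<gamma> * C..\<gamma>} h \<le> emeasure lborel (Pair h -` ?T)"
    proof cases
      case 1
      have "h\<^sup>2 < (\<gamma> * C)\<^sup>2" using 1 by (intro power_strict_mono) auto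
      then have "(k + 1) * h\<^sup>2 < (k + 1) * (\<gamma> * C)\<^sup>2" using k by (intro mult_strict_left_mono) auto
      also have "\<dots> = \<gamma>\<^sup>2 * ((k + 1) * C\<^sup>2)" by (simp add: power_mult_distrib)
      finally have lt: "k * h\<^sup>2 < \<gamma>\<^sup>2 - h\<^sup>2" unfolding C2 by (simp add: algebra_simps)
      have "ball 0 (sqrt (k * h\<^sup>2)) \<subseteq> Pair h -` ?T"
      proof
        fix y :: "real \<times> real" assume "y \<in> ball 0 (sqrt (k * h\<^sup>2))"
        then have "(norm y)\<^sup>2 \<le> (sqrt (k * h\<^sup>2))\<^sup>2" by (intro power_mono) auto
        then have "(norm y)\<^sup>2 \<le> k * h\<^sup>2" using k by simp
        then show "y \<in> Pair h -` ?T" using 1 lt by (intro mem) auto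
      qed
      then have "emeasure lborel (ball 0 (sqrt (k * h\<^sup>2)) :: (real \<times> real) set) \<le> emeasure lborel (Pair h -` ?T)"
        by (intro emeasure_mono meas)
      then show ?thesis using 1 k by (simp add: vol mult.assoc)
    next
      case 2
      have h0: "0 < h" using 2 \<gamma> C by (meson less_trans mult_pos_pos)
      have "(\<gamma> * C)\<^sup>2 < h\<^sup>2" using 2 \<gamma> C by (intro power_strict_mono) auto
      then have "(k + 1) * (\<gamma> * C)\<^sup>2 < (k + 1) * h\<^sup>2" using k by (intro mult_strict_left_mono) auto
      moreover have "(k + 1) * (\<gamma> * C)\<^sup>2 = \<gamma>\<^sup>2 * ((k + 1) * C\<^sup>2)" by (simp add: power_mult_distrib)
      ultimately have lt: "\<gamma>\<^sup>2 - h\<^sup>2 < k * h\<^sup>2" unfolding C2 by (simp add: algebra_simps)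
      have pos: "0 < \<gamma>\<^sup>2 - h\<^sup>2" using 2 h0 by (simp add: power_strict_mono)
      have "ball 0 (sqrt (\<gamma>\<^sup>2 - h\<^sup>2)) \<subseteq> Pair h -` ?T"
      proof
        fix y :: "real \<times> real" assume "y \<in> ball 0 (sqrt (\<gamma>\<^sup>2 - h\<^sup>2))"
        then have "(norm y)\<^sup>2 < (sqrt (\<gamma>\<^sup>2 - h\<^sup>2))\<^sup>2" by (intro power_strict_mono) auto
        then have "(norm y)\<^sup>2 < \<gamma>\<^sup>2 - h\<^sup>2" using pos by simp
        then show "y \<in> Pair h -` ?T" using h0 lt by (intro mem) auto
      qed
      then have "emeasure lborel (ball 0 (sqrt (\<gamma>\<^sup>2 - h\<^sup>2)) :: (real \<times> real) set) \<le> emeasure lborel (Pair h -` ?T)"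
        by (intro emeasure_mono meas)
      then show ?thesis using 2 pos by (simp add: vol)
    next
      case 3
      have "\<gamma> * C \<le> \<gamma>" "0 < \<gamma> * C" using \<gamma> C by (auto simp: mult_left_le)
      then show ?thesis using 3 by (auto simp: indicator_def)
    qed
  qed
  also have "(\<integral>\<^sup>+h. ennreal (pi * k * h\<^sup>2) * indicator {0..\<gamma> * C} h + ennreal (pi * (\<gamma>\<^sup>2 - h\<^sup>2)) * indicator {\<gamma> * C..\<gamma>} h \<partial>lborel)
     = (\<integral>\<^sup>+h. ennreal (pi * k * h\<^sup>2) * indicator {0..\<gamma> * C} h \<partial>lborel) + (\<integral>\<^sup>+h. ennreal (pi * (\<gamma>\<^sup>2 - h\<^sup>2)) * indicator {\<gamma> * C..\<gamma>} h \<partial>lborel)"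
    by (rule nn_integral_add) measurable
  also have "(\<integral>\<^sup>+h. ennreal (pi * k * h\<^sup>2) * indicator {0..\<gamma> * C} h \<partial>lborel) = ennreal (pi * k * (\<gamma> * C) ^ 3 / 3 - pi * k * 0 ^ 3 / 3)"
    using \<gamma> C k by (intro nn_integral_FTC_Icc) (auto intro!: derivative_eq_intros simp: power2_eq_square)
  also have "(\<integral>\<^sup>+h. ennreal (pi * (\<gamma>\<^sup>2 - h\<^sup>2)) * indicator {\<gamma> * C..\<gamma>} h \<partial>lborel) = ennreal (pi * (\<gamma>\<^sup>2 * \<gamma> - \<gamma> ^ 3 / 3) - pi * (\<gamma>\<^sup>2 * (\<gamma> * C) - (\<gamma> * C) ^ 3 / 3))"
  proof (rule nn_integral_FTC_Icc)
    fix h assume h: "h \<in> {\<gamma> * C..\<gamma>}"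
    show "((\<lambda>h. pi * (\<gamma>\<^sup>2 * h - h ^ 3 / 3)) has_real_derivative pi * (\<gamma>\<^sup>2 - h\<^sup>2)) (at h)"
      by (auto intro!: derivative_eq_intros simp: power2_eq_square)
    have "0 \<le> h" using h \<gamma> C by (meson atLeastAtMost_iff less_imp_le mult_nonneg_nonneg order_trans)
    then show "0 \<le> pi * (\<gamma>\<^sup>2 - h\<^sup>2)" using h by (simp add: power_mono)
  qed (use \<gamma> C in \<open>auto simp: mult_left_le\<close>)
  also have "ennreal (pi * k * (\<gamma> * C) ^ 3 / 3 - pi * k * 0 ^ 3 / 3) + ennreal (pi * (\<gamma>\<^sup>2 * \<gamma> - \<gamma> ^ 3 / 3) - pi * (\<gamma>\<^sup>2 * (\<gamma> * C) - (\<gamma> * C) ^ 3 / 3))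
     = ennreal (pi * k * (\<gamma> * C) ^ 3 / 3 + pi * \<gamma> ^ 3 * (2 / 3 - C + C ^ 3 / 3))"
  proof (subst ennreal_plus[symmetric])
    have eq: "pi * (\<gamma>\<^sup>2 * \<gamma> - \<gamma> ^ 3 / 3) - pi * (\<gamma>\<^sup>2 * (\<gamma> * C) - (\<gamma> * C) ^ 3 / 3) = pi * \<gamma> ^ 3 * (2 / 3 - C + C ^ 3 / 3)"
      by (simp add: field_simps eval_nat_numeral)
    have "2 / 3 - C + C ^ 3 / 3 = (1 - C)\<^sup>2 * (C + 2) / 3" by (simp add: field_simps eval_nat_numeral)
    moreover have "0 \<le> (1 - C)\<^sup>2 * (C + 2) / 3" using C by simp
    ultimately have "0 \<le> 2 / 3 - C + C ^ 3 / 3" by (simp only:)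
    then show "0 \<le> pi * (\<gamma>\<^sup>2 * \<gamma> - \<gamma> ^ 3 / 3) - pi * (\<gamma>\<^sup>2 * (\<gamma> * C) - (\<gamma> * C) ^ 3 / 3)"
        "ennreal (pi * k * (\<gamma> * C) ^ 3 / 3 - pi * k * 0 ^ 3 / 3 + (pi * (\<gamma>\<^sup>2 * \<gamma> - \<gamma> ^ 3 / 3) - pi * (\<gamma>\<^sup>2 * (\<gamma> * C) - (\<gamma> * C) ^ 3 / 3)))
         = ennreal (pi * k * (\<gamma> * C) ^ 3 / 3 + pi * \<gamma> ^ 3 * (2 / 3 - C + C ^ 3 / 3))"
      unfolding eq using \<gamma> by simp_all
  qed (use \<gamma> C k in simp)
  also have "pi * k * (\<gamma> * C) ^ 3 / 3 + pi * \<gamma> ^ 3 * (2 / 3 - C + C ^ 3 / 3) = 2 / 3 * pi * \<gamma> ^ 3 * (1 - C)"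
  proof -
    have "k * C ^ 3 = C - C ^ 3" using C by (simp add: k_def field_simps eval_nat_numeral)
    then have "pi * k * (\<gamma> * C) ^ 3 / 3 = pi * \<gamma> ^ 3 * (C - C ^ 3) / 3"
      by (metis (no_types, opaque_lifting) mult.assoc mult.left_commute power_mult_distrib)
    then show ?thesis by (simp add: field_simps)
  qed
  finally show ?thesis .
qed

section \<open>Surface measure of spherical caps\<close>

lemma sets_sphere_measure [simp, measurable_cong]: "sets (sphere_measure \<gamma>) = sets borel"
  by (simp add: sphere_measure_def)

lemma space_sphere_measure [simp]: "space (sphere_measure \<gamma>) = UNIV"
  by (simp add: sphere_measure_def)

lemma emeasure_sphere_measure:
  assumes [measurable]: "B \<in> sets borel"
  shows "emeasure (sphere_measure \<gamma>) B
    = ennreal (3 / \<gamma>) * emeasure lborel (ball 0 \<gamma> \<inter> {x. (\<gamma> / norm x) *\<^sub>R x \<in> B})"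
proof -
  have [measurable]: "(\<lambda>x::real^3. (\<gamma> / norm x) *\<^sub>R x) \<in> measurable borel borel" by measurable
  have X: "{x::real^3. (\<gamma> / norm x) *\<^sub>R x \<in> B} \<in> sets borel"
    using measurable_sets[of "\<lambda>x::real^3. (\<gamma> / norm x) *\<^sub>R x" borel borel B] by (simp add: vimage_def)
  have "emeasure (sphere_measure \<gamma>) B
      = emeasure (density lborel (\<lambda>x. ennreal (3 / \<gamma>) * indicator (ball 0 \<gamma>) x)) {x. (\<gamma> / norm x) *\<^sub>R x \<in> B}"
    unfolding sphere_measure_def by (subst emeasure_distr) (auto simp: vimage_def)
  also have "\<dots> = (\<integral>\<^sup>+x. ennreal (3 / \<gamma>) * indicator (ball 0 \<gamma>) x * indicator {x. (\<gamma> / norm x) *\<^sub>R x \<in> B} x \<partial>lborel)"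
    using X by (intro emeasure_density borel_measurable_times_ennreal borel_measurable_const borel_measurable_indicator) auto
  also have "\<dots> = (\<integral>\<^sup>+x. ennreal (3 / \<gamma>) * indicator (ball 0 \<gamma> \<inter> {x. (\<gamma> / norm x) *\<^sub>R x \<in> B}) x \<partial>lborel)"
    by (intro nn_integral_cong) (auto simp: indicator_def)
  also have "\<dots> = ennreal (3 / \<gamma>) * emeasure lborel (ball 0 \<gamma> \<inter> {x. (\<gamma> / norm x) *\<^sub>R x \<in> B})"
    using X by (intro nn_integral_cmult_indicator) auto
  finally show ?thesis .
qed

lemma finite_measure_sphere_measure: "finite_measure (sphere_measure \<gamma>)"
proof
  have "emeasure lborel (ball 0 \<gamma> :: (real^3) set) < \<infinity>" by (rule emeasure_bounded_finite) simp
  then show "emeasure (sphere_measure \<gamma>) (space (sphere_measure \<gamma>)) \<noteq> \<infinity>"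
    by (simp add: emeasure_sphere_measure ennreal_mult_eq_top_iff)
qed

text \<open>The cone over the cap contains the sector of
  \<open>emeasure_spherical_sector_ge\<close>, and 3/\<gamma> turns the volume of that sector into
  Archimedes' cap area. A lower bound suffices, as the model ball only has to be large.\<close>

lemma emeasure_sphere_cap_ge:
  assumes \<gamma>: "0 < \<gamma>" and \<phi>: "0 \<le> \<phi>" "\<phi> < pi / 2"
  shows "ennreal (2 * pi * \<gamma>\<^sup>2 * (1 - cos \<phi>)) \<le> emeasure (sphere_measure \<gamma>) {p. norm p = \<gamma> \<and> cos \<phi> \<le> p $ 1 / \<gamma>}"
proof -
  have C: "0 < cos \<phi>" "cos \<phi> \<le> 1" using \<phi> by (auto intro!: cos_gt_zero_pi)
  let ?B = "{p :: real^3. norm p = \<gamma> \<and> cos \<phi> \<le> p $ 1 / \<gamma>}"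
  have B[measurable]: "?B \<in> sets borel" by measurable
  have R: "{x::real^3. (\<gamma> / norm x) *\<^sub>R x \<in> ?B} \<in> sets borel"
    using measurable_sets[of "\<lambda>x::real^3. (\<gamma> / norm x) *\<^sub>R x" borel borel ?B] B by (simp add: vimage_def)
  have "2 * pi * \<gamma>\<^sup>2 * (1 - cos \<phi>) = 3 / \<gamma> * (2 / 3 * pi * \<gamma> ^ 3 * (1 - cos \<phi>))"
    using \<gamma> by (simp add: power2_eq_square power3_eq_cube)
  also have "ennreal \<dots> = ennreal (3 / \<gamma>) * ennreal (2 / 3 * pi * \<gamma> ^ 3 * (1 - cos \<phi>))"
    using \<gamma> by (intro ennreal_mult) auto
  also have "\<dots> \<le> ennreal (3 / \<gamma>) * emeasure lborel {x :: real^3. norm x < \<gamma> \<and> 0 < x $ 1 \<and> cos \<phi> * norm x \<le> x $ 1}"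
    by (intro mult_left_mono emeasure_spherical_sector_ge \<gamma> C) auto
  also have "\<dots> \<le> ennreal (3 / \<gamma>) * emeasure lborel (ball 0 \<gamma> \<inter> {x. (\<gamma> / norm x) *\<^sub>R x \<in> ?B})"
  proof (intro mult_left_mono emeasure_mono subsetI)
    fix x :: "real^3" assume "x \<in> {x. norm x < \<gamma> \<and> 0 < x $ 1 \<and> cos \<phi> * norm x \<le> x $ 1}"
    then have x: "norm x < \<gamma>" "0 < x $ 1" "cos \<phi> * norm x \<le> x $ 1" by auto
    then have "x \<noteq> 0" by auto
    then show "x \<in> ball 0 \<gamma> \<inter> {x. (\<gamma> / norm x) *\<^sub>R x \<in> ?B}"
      using x \<gamma> by (simp add: field_simps)
  qed (use R in auto)
  also have "\<dots> = emeasure (sphere_measure \<gamma>) ?B" by (rule emeasure_sphere_measure[symmetric]) measurable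
  finally show ?thesis .
qed

lemma one_minus_cos_ge: "x\<^sup>2 / 2 - x ^ 4 / 24 \<le> 1 - cos x" for x :: real
proof -
  obtain t where "cos x = (\<Sum>m<4. cos_coeff m * x ^ m) + cos (t + 1/2 * real 4 * pi) / fact 4 * x ^ 4"
    using Maclaurin_cos_expansion[of x 4] by blast
  moreover have "(\<Sum>m<4. cos_coeff m * x ^ m) = 1 - x\<^sup>2 / 2"
  proof -
    have "{..<4} = {0, 1, 2, 3::nat}" by auto
    then show ?thesis by (simp add: cos_coeff_def)
  qed
  moreover have "cos (t + 1/2 * real 4 * pi) / fact 4 * x ^ 4 \<le> 1 / 24 * x ^ 4"
    by (intro mult_right_mono) (auto simp: fact_numeral)
  ultimately show ?thesis by linarith
qed

text \<open>The Gamma recursion; it passes from the factor R^(n-2) to the volume constant of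
  R^n.\<close>

lemma unit_ball_vol_add_2: "0 \<le> k \<Longrightarrow> unit_ball_vol (k + 2) = 2 * pi / (k + 2) * unit_ball_vol k"
proof -
  assume k: "0 \<le> k"
  have 1: "pi powr ((k + 2) / 2) = pi powr (k / 2) * pi"
    by (simp add: add_divide_distrib powr_add)
  have 2: "Gamma ((k + 2) / 2 + 1) = (k + 2) / 2 * Gamma (k / 2 + 1)"
    using Gamma_plus1[of "k / 2 + 1"] k by (simp add: add_divide_distrib plus_of_nat_eq_0_imp nonpos_Ints_def)
  show ?thesis unfolding unit_ball_vol_def 1 2 by (simp add: mult_ac)
qed

lemma sphere_dist_axis:
  "0 < \<gamma> \<Longrightarrow> sphere_dist \<gamma> (axis 1 \<gamma>) p = \<gamma> * arccos (p $ 1 / \<gamma>)"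
  by (simp add: sphere_dist_def inner_axis' power2_eq_square)

text \<open>For a fixed Euclidean part of squared norm q the ball cuts the sphere in a cap. As
  \<epsilon> \<le> \<gamma>, its angle is at most 1, so the cosine reverses the order and replaces
  \<open>arccos\<close>. The clause on sqrt q stands apart because the real \<open>sqrt\<close> is
  odd: for q > \<epsilon>^2 the cosine condition alone would not exclude the point.\<close>

lemma product_ball_iff:
  fixes p :: "real^3"
  assumes \<gamma>: "0 < \<gamma>" and \<epsilon>: "0 < \<epsilon>" "\<epsilon> \<le> \<gamma>" and p: "norm p = \<gamma>" and q: "0 \<le> q"
  shows "sqrt ((sphere_dist \<gamma> (axis 1 \<gamma>) p)\<^sup>2 + q) \<le> \<epsilon> \<longleftrightarrow> sqrt q \<le> \<epsilon> \<and> cos (sqrt (\<epsilon>\<^sup>2 - q) / \<gamma>) \<le> p $ 1 / \<gamma>"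
proof -
  define u where "u = arccos (p $ 1 / \<gamma>)"
  have "\<bar>p $ 1\<bar> \<le> \<gamma>" using component_le_norm_cart[of p 1] p by simp
  then have b: "- 1 \<le> p $ 1 / \<gamma>" "p $ 1 / \<gamma> \<le> 1" using \<gamma> by (auto simp: field_simps)
  have u: "0 \<le> u" "u \<le> pi" "cos u = p $ 1 / \<gamma>"
    unfolding u_def using b arccos_lbound arccos_ubound cos_arccos by auto
  have "sqrt ((sphere_dist \<gamma> (axis 1 \<gamma>) p)\<^sup>2 + q) \<le> \<epsilon> \<longleftrightarrow> (\<gamma> * u)\<^sup>2 + q \<le> \<epsilon>\<^sup>2"
    using \<epsilon> q \<gamma> by (simp add: sphere_dist_axis u_def real_sqrt_le_iff')
  also have "\<dots> \<longleftrightarrow> q \<le> \<epsilon>\<^sup>2 \<and> (\<gamma> * u)\<^sup>2 \<le> \<epsilon>\<^sup>2 - q"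
    by (auto intro: order_trans[rotated])
  also have "\<dots> \<longleftrightarrow> sqrt q \<le> \<epsilon> \<and> cos (sqrt (\<epsilon>\<^sup>2 - q) / \<gamma>) \<le> p $ 1 / \<gamma>"
  proof (cases "q \<le> \<epsilon>\<^sup>2")
    case True
    define v where "v = sqrt (\<epsilon>\<^sup>2 - q) / \<gamma>"
    have "sqrt (\<epsilon>\<^sup>2 - q) \<le> \<gamma>"
    proof (rule real_le_lsqrt)
      have "\<epsilon>\<^sup>2 \<le> \<gamma>\<^sup>2" using \<epsilon> by (intro power_mono) auto
      then show "\<epsilon>\<^sup>2 - q \<le> \<gamma>\<^sup>2" using q by linarith
    qed (use True \<gamma> in auto)
    then have v: "0 \<le> v" "v \<le> 1" using \<gamma> True by (auto simp: v_def)
    have "(\<gamma> * u)\<^sup>2 \<le> \<epsilon>\<^sup>2 - q \<longleftrightarrow> \<gamma> * u \<le> sqrt (\<epsilon>\<^sup>2 - q)"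
      using real_sqrt_le_iff[of "(\<gamma> * u)\<^sup>2" "\<epsilon>\<^sup>2 - q"] \<gamma> u by simp
    also have "\<dots> \<longleftrightarrow> u \<le> v" using \<gamma> by (simp add: v_def field_simps)
    also have "\<dots> \<longleftrightarrow> cos v \<le> cos u" using u v pi_gt3 by (intro cos_mono_le_eq[symmetric]) auto
    finally show ?thesis using True q \<epsilon> u by (simp add: v_def real_sqrt_le_iff')
  next
    case False
    then show ?thesis using q \<epsilon> by (simp add: real_sqrt_le_iff')
  qed
  finally show ?thesis .
qed

text \<open>Over each v the slice is a cap of area at least pi Q - pi Q^2/(12 \<gamma>^2), where Q =
  \<epsilon>^2 - |v|^2, by the Taylor bound for the cosine. The layer cake formula reduces the
  integral over v to one over the radius.\<close>

lemma vol_SxE_ge: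
  fixes n :: nat
  assumes n: "2 \<le> n" and \<gamma>: "0 < \<gamma>" and \<epsilon>: "0 < \<epsilon>" "\<epsilon> \<le> \<gamma>"
  shows "ennreal (vol_E n \<epsilon> * (1 - 1 / (3 * \<gamma>\<^sup>2 * (real n + 2)) * \<epsilon>\<^sup>2)) \<le> vol_SxE \<gamma> n \<epsilon>"
proof -
  define k where "k = n - 2"
  have nk: "real n = real k + 2" "n = k + 2" using n by (auto simp: k_def)
  let ?P = "\<Pi>\<^sub>M i\<in>{..<k}. (lborel :: real measure)"
  let ?S = "sphere_measure \<gamma>"
  interpret S: finite_measure ?S by (rule finite_measure_sphere_measure)
  interpret P: finite_product_sigma_finite "\<lambda>_. lborel :: real measure" "{..<k}" by standard auto
  interpret pair_sigma_finite ?S ?P ..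
  define f :: "(nat \<Rightarrow> real) \<Rightarrow> real" where "f v = sqrt (\<Sum>i<k. (v i)\<^sup>2)" for v
  have f[measurable]: "f \<in> borel_measurable ?P" unfolding f_def by measurable
  have f0: "0 \<le> f v" "(f v)\<^sup>2 = (\<Sum>i<k. (v i)\<^sup>2)" for v by (auto simp: f_def sum_nonneg)
  let ?E = "{w \<in> space (?S \<Otimes>\<^sub>M ?P). norm (fst w) = \<gamma> \<and> f (snd w) \<le> \<epsilon> \<and> cos (sqrt (\<epsilon>\<^sup>2 - (f (snd w))\<^sup>2) / \<gamma>) \<le> fst w $ 1 / \<gamma>}"
  have E: "?E \<in> sets (?S \<Otimes>\<^sub>M ?P)"
  proof -
    let ?Q = "?S \<Otimes>\<^sub>M ?P"
    have "(\<lambda>p::real^3. norm p) \<in> borel_measurable ?S" "(\<lambda>p::real^3. p $ 1 / \<gamma>) \<in> borel_measurable ?S"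
      unfolding measurable_cong_sets[OF sets_sphere_measure refl] by measurable
    then have m: "(\<lambda>w. norm (fst w)) \<in> borel_measurable ?Q" "(\<lambda>w. fst w $ 1 / \<gamma>) \<in> borel_measurable ?Q"
      by (auto intro: measurable_compose[OF measurable_fst])
    have "(\<lambda>v. cos (sqrt (\<epsilon>\<^sup>2 - (f v)\<^sup>2) / \<gamma>)) \<in> borel_measurable ?P" by measurable
    then have m': "(\<lambda>w. cos (sqrt (\<epsilon>\<^sup>2 - (f (snd w))\<^sup>2) / \<gamma>)) \<in> borel_measurable ?Q"
        "(\<lambda>w. f (snd w)) \<in> borel_measurable ?Q"
      using f by (auto intro: measurable_compose[OF measurable_snd])
    have "?E = {w \<in> space ?Q. norm (fst w) = \<gamma>} \<inter> {w \<in> space ?Q. f (snd w) \<le> \<epsilon>}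
        \<inter> {w \<in> space ?Q. cos (sqrt (\<epsilon>\<^sup>2 - (f (snd w))\<^sup>2) / \<gamma>) \<le> fst w $ 1 / \<gamma>}"
      by blast
    also have "\<dots> \<in> sets ?Q"
      by (intro sets.Int borel_measurable_eq borel_measurable_le m m' borel_measurable_const)
    finally show ?thesis .
  qed
  have "{(p, v). norm p = \<gamma> \<and> v \<in> (\<Pi>\<^sub>E i\<in>{..<k}. UNIV) \<and>
          sqrt ((sphere_dist \<gamma> (axis 1 \<gamma>) p)^2 + (\<Sum>i<k. (v i)^2)) \<le> \<epsilon>} = ?E"
  proof (rule set_eqI)
    fix w :: "(real^3) \<times> (nat \<Rightarrow> real)"
    have sp: "w \<in> space (?S \<Otimes>\<^sub>M ?P) \<longleftrightarrow> snd w \<in> (\<Pi>\<^sub>E i\<in>{..<k}. UNIV)"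
      by (cases w) (simp add: space_pair_measure space_PiM)
    have "sqrt ((sphere_dist \<gamma> (axis 1 \<gamma>) (fst w))\<^sup>2 + (f (snd w))\<^sup>2) \<le> \<epsilon> \<longleftrightarrow>
        f (snd w) \<le> \<epsilon> \<and> cos (sqrt (\<epsilon>\<^sup>2 - (f (snd w))\<^sup>2) / \<gamma>) \<le> fst w $ 1 / \<gamma>" if "norm (fst w) = \<gamma>"
      using product_ball_iff[OF \<gamma> \<epsilon> that, of "(f (snd w))\<^sup>2"] f0(1)[of "snd w"] by simp
    then show "w \<in> {(p, v). norm p = \<gamma> \<and> v \<in> (\<Pi>\<^sub>E i\<in>{..<k}. UNIV) \<and>
          sqrt ((sphere_dist \<gamma> (axis 1 \<gamma>) p)^2 + (\<Sum>i<k. (v i)^2)) \<le> \<epsilon>} \<longleftrightarrow> w \<in> ?E"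
      unfolding f0(2)[symmetric] mem_Collect_eq case_prod_beta sp by blast
  qed
  then have "vol_SxE \<gamma> n \<epsilon> = emeasure (?S \<Otimes>\<^sub>M ?P) ?E"
    unfolding vol_SxE_def k_def[symmetric] by simp
  also have "\<dots> = (\<integral>\<^sup>+v. emeasure ?S ((\<lambda>p. (p, v)) -` ?E) \<partial>?P)"
    by (rule emeasure_pair_measure_alt2[OF E])
  finally have vol: "vol_SxE \<gamma> n \<epsilon> = (\<integral>\<^sup>+v. emeasure ?S ((\<lambda>p. (p, v)) -` ?E) \<partial>?P)" .
  \<comment> \<open>The sign makes G increasing on [0, \<epsilon>] with G \<epsilon> = 0: then G
    \<epsilon> - G (f v) is the area bound of the slice, and the derivative g is nonnegative as
    \<open>nn_integral_layer_cake\<close> demands.\<close>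
  define G where "G s = - (pi * (\<epsilon>\<^sup>2 - s\<^sup>2) - pi * (\<epsilon>\<^sup>2 - s\<^sup>2)\<^sup>2 / (12 * \<gamma>\<^sup>2))" for s :: real
  define g where "g s = 2 * pi * s * (1 - (\<epsilon>\<^sup>2 - s\<^sup>2) / (6 * \<gamma>\<^sup>2))" for s :: real
  have le: "ennreal (G \<epsilon> - G (f v)) * indicator {v \<in> space ?P. f v \<le> \<epsilon>} v \<le> emeasure ?S ((\<lambda>p. (p, v)) -` ?E)" for v
  proof (cases "v \<in> space ?P \<and> f v \<le> \<epsilon>")
    case True
    define \<phi> where "\<phi> = sqrt (\<epsilon>\<^sup>2 - (f v)\<^sup>2) / \<gamma>"
    have q: "(f v)\<^sup>2 \<le> \<epsilon>\<^sup>2" using True f0 by (intro power_mono) auto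
    have "sqrt (\<epsilon>\<^sup>2 - (f v)\<^sup>2) \<le> \<gamma>"
    proof (rule real_le_lsqrt)
      have "\<epsilon>\<^sup>2 \<le> \<gamma>\<^sup>2" using \<epsilon> by (intro power_mono) auto
      moreover have "0 \<le> (f v)\<^sup>2" by simp
      ultimately show "\<epsilon>\<^sup>2 - (f v)\<^sup>2 \<le> \<gamma>\<^sup>2" by linarith
    qed (use q \<gamma> in auto)
    then have \<phi>: "0 \<le> \<phi>" "\<phi> \<le> 1" using \<gamma> q by (auto simp: \<phi>_def)
    have \<phi>2: "\<gamma>\<^sup>2 * \<phi>\<^sup>2 = \<epsilon>\<^sup>2 - (f v)\<^sup>2" using \<gamma> q by (simp add: \<phi>_def power_divide)
    have "G \<epsilon> - G (f v) = 2 * pi * \<gamma>\<^sup>2 * (\<phi>\<^sup>2 / 2 - \<phi> ^ 4 / 24)"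
    proof -
      have "\<phi> ^ 4 = \<phi>\<^sup>2 * \<phi>\<^sup>2" by (simp flip: power_add)
      then show ?thesis using \<gamma> unfolding G_def \<phi>2[symmetric] by (simp add: field_simps power2_eq_square)
    qed
    also have "\<dots> \<le> 2 * pi * \<gamma>\<^sup>2 * (1 - cos \<phi>)" by (intro mult_left_mono one_minus_cos_ge) auto
    finally have "ennreal (G \<epsilon> - G (f v)) \<le> ennreal (2 * pi * \<gamma>\<^sup>2 * (1 - cos \<phi>))" by (rule ennreal_leI)
    also have "\<dots> \<le> emeasure ?S {p. norm p = \<gamma> \<and> cos \<phi> \<le> p $ 1 / \<gamma>}"
      using \<phi> pi_gt3 by (intro emeasure_sphere_cap_ge \<gamma>) auto
    also have "{p. norm p = \<gamma> \<and> cos \<phi> \<le> p $ 1 / \<gamma>} = (\<lambda>p. (p, v)) -` ?E"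
      using True by (auto simp: space_pair_measure \<phi>_def)
    finally show ?thesis using True by simp
  next
    case False
    then have "indicator {v \<in> space ?P. f v \<le> \<epsilon>} v = (0::ennreal)" by auto
    then show ?thesis by simp
  qed
  define \<omega> where "\<omega> = unit_ball_vol (real k)"
  have \<omega>: "0 \<le> \<omega>" by (simp add: \<omega>_def)
  have g0: "0 \<le> g s" if "0 \<le> s" for s
  proof -
    have "\<epsilon>\<^sup>2 \<le> \<gamma>\<^sup>2" using \<epsilon> by (intro power_mono) auto
    moreover have "0 \<le> s\<^sup>2" "0 < \<gamma>\<^sup>2" using \<gamma> by auto
    ultimately have "\<epsilon>\<^sup>2 - s\<^sup>2 \<le> 6 * \<gamma>\<^sup>2" by linarith
    then have "(\<epsilon>\<^sup>2 - s\<^sup>2) / (6 * \<gamma>\<^sup>2) \<le> 1" using \<gamma> by simp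
    then show ?thesis using that by (simp add: g_def)
  qed
  define a where "a = 1 / (6 * \<gamma>\<^sup>2)"
  \<comment> \<open>Antiderivative of g s = 2 pi s (1 - a \<epsilon>^2 + a s^2) times the volume
    \<omega> s^k of the s-ball in R^k.\<close>
  define H where "H s = 2 * pi * \<omega> * ((1 - a * \<epsilon>\<^sup>2) / (real k + 2) * s ^ (k + 2) + a / (real k + 4) * s ^ (k + 4))" for s :: real
  have H: "(H has_real_derivative g s * (\<omega> * s ^ k)) (at s)" for s
  proof -
    have "((\<lambda>s. C / real (k + m) * s ^ (k + m)) has_real_derivative C * s ^ (k + m - 1)) (at s)" if "0 < m" for C m
      by (rule DERIV_cong[OF DERIV_cmult[OF DERIV_pow]]) (use that in simp)
    from this[of 2 "1 - a * \<epsilon>\<^sup>2"] this[of 4 a]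
    have "(H has_real_derivative 2 * pi * \<omega> * ((1 - a * \<epsilon>\<^sup>2) * s ^ (k + 1) + a * s ^ (k + 3))) (at s)"
      unfolding H_def by (intro DERIV_cmult DERIV_add) (simp_all add: add.commute)
    moreover have "2 * pi * \<omega> * ((1 - a * \<epsilon>\<^sup>2) * s ^ (k + 1) + a * s ^ (k + 3)) = g s * (\<omega> * s ^ k)"
      by (simp add: g_def a_def power_add eval_nat_numeral algebra_simps diff_divide_distrib)
    ultimately show ?thesis by (rule DERIV_cong)
  qed
  have "vol_E n \<epsilon> * (1 - 1 / (3 * \<gamma>\<^sup>2 * (real n + 2)) * \<epsilon>\<^sup>2) = H \<epsilon> - H 0"
  proof -
    have "unit_ball_vol (real n) = 2 * pi / (real k + 2) * \<omega>"
      unfolding nk(1) \<omega>_def by (rule unit_ball_vol_add_2) simp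
    \<comment> \<open>Here 1/(k + 2) - 1/(k + 4) = 2/((k + 2)(k + 4)) produces the denominator k + 4
      = n + 2.\<close>
    moreover have "(1 - a * \<epsilon>\<^sup>2) / (real k + 2) + a * \<epsilon>\<^sup>2 / (real k + 4) = 1 / (real k + 2) * (1 - 2 * a / (real k + 4) * \<epsilon>\<^sup>2)"
      by (simp add: field_simps)
    moreover have "1 / (3 * \<gamma>\<^sup>2 * (real n + 2)) = 2 * a / (real k + 4)" by (simp add: a_def nk(1))
    moreover have "H \<epsilon> = 2 * pi * \<omega> * \<epsilon> ^ (k + 2) * ((1 - a * \<epsilon>\<^sup>2) / (real k + 2) + a * \<epsilon>\<^sup>2 / (real k + 4))"
      by (simp add: H_def power_add eval_nat_numeral algebra_simps)
    moreover have "H 0 = 0" by (simp add: H_def)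
    ultimately show ?thesis by (simp add: vol_E_def nk(2))
  qed
  also have "ennreal \<dots> = (\<integral>\<^sup>+s. ennreal (g s * (\<omega> * s ^ k)) * indicator {0..\<epsilon>} s \<partial>lborel)"
    using H g0 \<omega> \<epsilon> by (intro nn_integral_FTC_Icc[symmetric]) (auto simp: g_def)
  also have "\<dots> = (\<integral>\<^sup>+s. ennreal (g s) * emeasure ?P {v \<in> space ?P. f v \<le> s} * indicator {0..\<epsilon>} s \<partial>lborel)"
  proof (intro nn_integral_cong)
    fix s :: real
    show "ennreal (g s * (\<omega> * s ^ k)) * indicator {0..\<epsilon>} s = ennreal (g s) * emeasure ?P {v \<in> space ?P. f v \<le> s} * indicator {0..\<epsilon>} s"
    proof (cases "0 < s \<and> s \<le> \<epsilon>")
      case True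
      have "emeasure ?P {v \<in> space ?P. f v \<le> s} = emeasure ?P ({v. sqrt (\<Sum>i<k. (v i)\<^sup>2) \<le> s} \<inter> space ?P)"
        by (intro arg_cong[where f="emeasure ?P"]) (auto simp: f_def)
      also have "\<dots> = ennreal (\<omega> * s ^ k)"
        using emeasure_cball_aux[of "{..<k}" s] True by (simp add: \<omega>_def)
      finally show ?thesis using True g0[of s] \<omega> by (simp add: ennreal_mult)
    next
      case False
      \<comment> \<open>The ball volume formula requires a positive radius; at s = 0 the factor g
        vanishes.\<close>
      then have "s = 0 \<or> s \<notin> {0..\<epsilon>}" by auto
      then show ?thesis by (auto simp: g_def)
    qed
  qed
  also have "\<dots> = (\<integral>\<^sup>+v. ennreal (G \<epsilon> - G (f v)) * indicator {v \<in> space ?P. f v \<le> \<epsilon>} v \<partial>?P)"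
  proof (rule nn_integral_layer_cake[symmetric])
    show "sigma_finite_measure ?P" ..
    show "(G has_real_derivative g s) (at s)" for s
    proof -
      have "((\<lambda>s. - (pi * (\<epsilon>\<^sup>2 - s\<^sup>2) - pi * (\<epsilon>\<^sup>2 - s\<^sup>2)\<^sup>2 * c)) has_real_derivative
          2 * pi * s * (1 - (\<epsilon>\<^sup>2 - s\<^sup>2) * (2 * c))) (at s)" for c :: real
        by (auto intro!: derivative_eq_intros simp: algebra_simps)
      from this[of "1 / (12 * \<gamma>\<^sup>2)"] show ?thesis
        unfolding G_def g_def by simp
    qed
  qed (use f0 g0 in \<open>auto simp: g_def\<close>)
  also have "\<dots> \<le> vol_SxE \<gamma> n \<epsilon>" unfolding vol by (rule nn_integral_mono) (rule le)
  finally show ?thesis .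
qed

section \<open>Comparison of the second-order coefficients\<close>

theorem theorem2p6:
  fixes \<mu> :: "('a::polish_space) measure" and n :: nat and \<kappa> :: real
  assumes "n \<ge> 2" and "\<kappa> \<ge> 0"
    and "mm_space \<mu>"
    and "n_dimensional n \<mu>"
    and "CD \<kappa> (real n) \<mu>"
  shows "(\<kappa> = 0 \<longrightarrow> Sc_vol_ge_0 n \<mu>) \<and> (\<kappa> > 0 \<longrightarrow> Sc_vol_ge_pos n (real n * \<kappa>) \<mu>)"
proof (intro conjI impI)
  assume "\<kappa> = 0"
  \<comment> \<open>For \<kappa> = 0 the restriction \<kappa> \<epsilon>^2 < 1 always holds, so any
    radius serves; 1 is arbitrary.\<close>
  then show "Sc_vol_ge_0 n \<mu>"
    unfolding Sc_vol_ge_0_def using CD_emeasure_cball_le[OF assms]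
    by (intro exI[of _ 1]) simp
next
  assume \<kappa>: "\<kappa> > 0"
  show "Sc_vol_ge_pos n (real n * \<kappa>) \<mu>"
    unfolding Sc_vol_ge_pos_def
  proof (intro allI impI)
    fix \<gamma> :: real assume less: "sqrt (2 / (real n * \<kappa>)) < \<gamma>"
    have n: "0 < real n" using assms(1) by simp
    have "0 < sqrt (2 / (real n * \<kappa>))" using n \<kappa> by simp
    with less have \<gamma>: "0 < \<gamma>" by linarith
    have "(sqrt (2 / (real n * \<kappa>)))\<^sup>2 < \<gamma>\<^sup>2" using less n \<kappa> by (intro power_strict_mono) auto
    then have "2 / (real n * \<kappa>) < \<gamma>\<^sup>2" using n \<kappa> by simp
    then have \<gamma>2: "2 < \<gamma>\<^sup>2 * (real n * \<kappa>)" using n \<kappa> by (simp add: field_simps)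
    \<comment> \<open>a and b are the relative second-order volume losses in the model and in X. The
      assumption on \<gamma> says a < b, and strictness leaves room for the higher-order term in
      \<open>ev2\<close>.\<close>
    define a where "a = 1 / (3 * \<gamma>\<^sup>2 * (real n + 2))"
    define b where "b = real n * \<kappa> / (6 * (real n + 2))"
    have ab: "a < b"
    proof -
      have "a = 2 / (\<gamma>\<^sup>2 * (6 * (real n + 2)))"
        using \<gamma> by (simp add: a_def divide_simps)
      also have "\<dots> < (\<gamma>\<^sup>2 * (real n * \<kappa>)) / (\<gamma>\<^sup>2 * (6 * (real n + 2)))"
        using \<gamma>2 \<gamma> by (intro divide_strict_right_mono) auto
      also have "\<dots> = b" using \<gamma> by (simp add: b_def)
      finally show ?thesis .
    qed
    have "((\<lambda>\<epsilon>. \<kappa> * \<epsilon>\<^sup>2) \<longlongrightarrow> 0) (at_right 0)" by (auto intro!: tendsto_eq_intros)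
    then have ev1: "\<forall>\<^sub>F \<epsilon> in at_right 0. \<kappa> * \<epsilon>\<^sup>2 < 1" by (rule order_tendstoD) simp
    have "((\<lambda>\<epsilon>. a * (\<kappa> / 6) * \<epsilon>\<^sup>2) \<longlongrightarrow> 0) (at_right 0)" by (auto intro!: tendsto_eq_intros)
    then have ev2: "\<forall>\<^sub>F \<epsilon> in at_right 0. a * (\<kappa> / 6) * \<epsilon>\<^sup>2 < b - a" by (rule order_tendstoD) (use ab in simp)
    have ev3: "\<forall>\<^sub>F \<epsilon> in at_right 0. \<epsilon> < \<gamma>" using \<gamma> by (intro eventually_at_rightI[of 0 \<gamma>]) auto
    have "\<forall>\<^sub>F \<epsilon> in at_right 0. \<kappa> * \<epsilon>\<^sup>2 < 1 \<and> a * (\<kappa> / 6) * \<epsilon>\<^sup>2 < b - a \<and> \<epsilon> < \<gamma>"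
      using ev1 ev2 ev3 by eventually_elim simp
    then obtain r where r: "0 < r" "\<And>\<epsilon>. 0 < \<epsilon> \<Longrightarrow> \<epsilon> < r \<Longrightarrow> \<kappa> * \<epsilon>\<^sup>2 < 1 \<and> a * (\<kappa> / 6) * \<epsilon>\<^sup>2 < b - a \<and> \<epsilon> < \<gamma>"
      unfolding eventually_at_right_field by blast
    show "\<exists>r>0. \<forall>x \<epsilon>. 0 < \<epsilon> \<and> \<epsilon> \<le> r \<longrightarrow> emeasure \<mu> (cball x \<epsilon>) < vol_SxE \<gamma> n \<epsilon>"
    \<comment> \<open>Half of r, because the estimates hold for \<epsilon> strictly below r while
      the goal includes its end point.\<close>
    proof (intro exI[of _ "r / 2"] conjI allI impI)
      fix x \<epsilon> assume "0 < \<epsilon> \<and> \<epsilon> \<le> r / 2"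
      then have \<epsilon>: "0 < \<epsilon>" "\<kappa> * \<epsilon>\<^sup>2 < 1" "a * (\<kappa> / 6) * \<epsilon>\<^sup>2 < b - a" "\<epsilon> < \<gamma>" using r by auto
      obtain M where M: "emeasure \<mu> (cball x \<epsilon>) = ennreal M" "0 < M"
          "M * (1 + \<kappa> / 6 * \<epsilon>\<^sup>2) \<le> vol_E n \<epsilon> * (1 + \<kappa> / 3 * \<epsilon>\<^sup>2 / (real n + 2))"
        by (rule CD_measure_cball_le[OF assms \<epsilon>(1,2)])
      have "M < vol_E n \<epsilon> * (1 - a * \<epsilon>\<^sup>2)"
        by (rule volume_ratio_less[OF _ _ assms(2) M(3)]) (use \<epsilon> in \<open>auto simp: vol_E_def b_def\<close>)
      then have "ennreal M < ennreal (vol_E n \<epsilon> * (1 - a * \<epsilon>\<^sup>2))" using M(2) by (intro ennreal_lessI) auto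
      also have "\<dots> \<le> vol_SxE \<gamma> n \<epsilon>"
        unfolding a_def using vol_SxE_ge[OF assms(1) \<gamma>] \<epsilon> by simp
      finally show "emeasure \<mu> (cball x \<epsilon>) < vol_SxE \<gamma> n \<epsilon>" unfolding M(1) .
    qed (use r in auto)
  qed
qed

end
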